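(* Let $(D,\mu)$ be a probability space and let $V_m\subset L_2(D,\mu)\cap B(D)$ be a linear space with $\dim(V_m)=m\ge 1$. Let $n\ge m$ be an integer. (1) There exist points $x_1,\dots,x_{2n}\in D$ such that, for all $f\in V_m$ and all $2\le p\le\infty$, $$\Big(1-\sqrt{\tfrac{m}{n}}\Big)\cdot\|f\|_p\ \le\ m^{\frac12-\frac1p}\cdot\sqrt{\frac1n\sum_{i=1}^{2n}|f(x_i)|^2}.$$ (2) For each $p\in\{2,\infty\}$, one can take $n$ points instead of $2n$ points: there exist $x_1,\dots,x_n\in D$ such that, for all $f\in V_m$, the same inequality holds with $\sum_{i=1}^{2n}$ replaced by $\sum_{i=1}^{n}$. (3) In the case $n=m$, the factor $1-\sqrt{m/n}$ can be replaced by $\frac1{2m}$ in these statements.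
   Context: Functions are complex-valued; $L_2(D,\mu)$ consists of functions, not equivalence classes. $B(D)$ is the space of bounded functions on $D$. For $p<\infty$, $\|\cdot\|_p$ is the norm of $L_p(D,\mu)$; $\|f\|_\infty=\sup_{x\in D}|f(x)|$ is the sup-norm, and $1/\infty=0$. *)

theory Defs
  imports "HOL-Probability.Probability" "HOL-Library.Function_Algebras"
begin

text \<open>
  The complex-valued functions on a set \<open>D\<close> are encoded as those functions on the ambient
  type that vanish outside \<open>D\<close>. Hence two of them are equal iff they agree at every point
  of \<open>D\<close>, and linear (in)dependence and dimension are those of genuine functions on \<open>D\<close>;
  no identification modulo null sets takes place.
\<close>

definition functions_on :: "'a set \<Rightarrow> ('a \<Rightarrow> complex) set" where
  "functions_on D = {f. \<forall>x. x \<notin> D \<longrightarrow> f x = 0}"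

definition bounded_functions :: "'a set \<Rightarrow> ('a \<Rightarrow> complex) set" where
  "bounded_functions D = {f \<in> functions_on D. bounded (f ` D)}"

definition L2_functions :: "'a measure \<Rightarrow> ('a \<Rightarrow> complex) set" where
  "L2_functions M =
     {f \<in> functions_on (space M). f \<in> borel_measurable M \<and> integrable M (\<lambda>x. (cmod (f x))\<^sup>2)}"

definition scale_fun :: "complex \<Rightarrow> ('a \<Rightarrow> complex) \<Rightarrow> 'a \<Rightarrow> complex" where
  "scale_fun c f = (\<lambda>x. c * f x)"

text \<open>
  Note that \<open>cfun.dim V\<close> is 0 if \<open>V\<close> is infinite-dimensional, so an assumption
  \<open>cfun.dim V = m\<close> with \<open>m \<ge> 1\<close> forces \<open>V\<close> to be finite-dimensional.
\<close>

global_interpretation cfun: vector_space "scale_fun :: complex \<Rightarrow> ('a \<Rightarrow> complex) \<Rightarrow> 'a \<Rightarrow> complex"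
  by unfold_locales (auto simp: scale_fun_def fun_eq_iff algebra_simps)

text \<open>
  For \<open>p = \<infinity>\<close> this is the supremum over all points of the space, not the
  essential supremum. The values are meaningful only for bounded \<open>f\<close> if \<open>p = \<infinity>\<close>, and
  only if \<open>|f|\<close> to the power \<open>p\<close> is integrable otherwise; both hold for
  bounded measurable functions on a probability space.
\<close>

definition Lp_norm :: "'a measure \<Rightarrow> ereal \<Rightarrow> ('a \<Rightarrow> complex) \<Rightarrow> real" where
  "Lp_norm M p f =
     (if p = \<infinity> then (SUP x\<in>space M. cmod (f x))
      else (\<integral>x. cmod (f x) powr real_of_ereal p \<partial>M) powr (1 / real_of_ereal p))"

end

theory Submission
  imports Defs "Jordan_Normal_Form.Determinant"
begin

text \<open>
  Fix a basis of \<open>V\<close> and let \<open>\<phi> x\<close> be the vector of the conjugated values of the basis functions at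
  \<open>x\<close>. A function with coordinate vector \<open>c\<close> then satisfies \<open>f x = \<langle>c, \<phi> x\<rangle>\<close>, and the theorem becomes a
  statement about the bounded set \<open>S = \<phi> ` D\<close> of vectors in complex \<open>m\<close>-space: one looks for
  \<open>v\<^sub>1, \<dots>, v\<^sub>n \<in> S\<close> such that the form \<open>\<Sum>\<^sub>i |\<langle>c, v\<^sub>i\<rangle>|\<^sup>2\<close> is large.

  \<^bold>\<open>Selecting vectors.\<close> Suppose that a positive definite matrix \<open>G\<close> is an average of rank-one matrices
  \<open>v v\<^sup>*\<close> with \<open>v \<in> S\<close>. For \<open>n > m\<close> one can choose \<open>n\<close> vectors of \<open>S\<close>, one after the other, with
  \<open>\<Sum>\<^sub>i |\<langle>c, v\<^sub>i\<rangle>|\<^sup>2 \<ge> (\<surd>n - \<surd>m)\<^sup>2 c\<^sup>* G c\<close> for all \<open>c\<close> (\<open>unweighted_selection\<close>). This is the lower half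
  of the barrier method of Batson, Spielman and Srivastava. The sums \<open>A\<^sub>k = \<Sum>\<^sub>i\<^sub>\<le>\<^sub>k v\<^sub>i v\<^sub>i\<^sup>*\<close> are kept above
  a barrier \<open>l\<^sub>k G\<close> whose level rises by a constant amount in each step, while the potential
  \<open>tr ((A\<^sub>k - l\<^sub>k G)\<^sup>-\<^sup>1 G)\<close>, which measures the proximity to the barrier, does not increase; the next vector
  exists because the required inequality holds on average (\<open>barrier_step\<close>). With two barriers the method
  needs weights; with the lower barrier alone the step size can be tuned so that weight one suffices. As the
  potential stays bounded, the final form exceeds the barrier by a fixed multiple of \<open>G\<close>, and this
  slack is used below.

  \<^bold>\<open>The norm with exponent 2.\<close> Take for \<open>G\<close> the Gram matrix of the basis in \<open>L\<^sub>2(\<mu>)\<close>. It is an average of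
  rank-one matrices by definition, but it may be singular because functions that vanish almost everywhere
  need not vanish. So one mixes in a small multiple of a definite average; the slack pays for it.

  \<^bold>\<open>The sup-norm.\<close> By the idea of Kiefer and Wolfowitz, an average \<open>G\<close> whose determinant is almost maximal
  satisfies \<open>v\<^sup>* G\<^sup>-\<^sup>1 v \<le> m + \<eta>\<close> for all \<open>v \<in> S\<close>, since otherwise moving mass to \<open>v\<close> would increase the
  determinant (\<open>near_optimal_design\<close>). Hence \<open>|f x|\<^sup>2 \<le> (m + \<eta>) c\<^sup>* G c\<close>. The determinant
  is only almost maximal because \<open>S\<close> need not be closed; the slack absorbs \<open>\<eta>\<close>.

  \<^bold>\<open>All exponents.\<close> Joining the two point sets gives \<open>2n\<close> points that serve both endpoints, and
  \<open>\<parallel>f\<parallel>\<^sub>p \<le> \<parallel>f\<parallel>\<^sub>2\<^sup>\<theta> \<parallel>f\<parallel>\<^sub>\<infinity>\<^sup>1\<^sup>-\<^sup>\<theta>\<close> with \<open>\<theta> = 2/p\<close> gives the exponents between them.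

  \<^bold>\<open>The case \<open>n = m\<close>.\<close> Here the factor \<open>1 - \<surd>(m/n)\<close> vanishes. Instead, take points that maximise the
  determinant of \<open>\<phi> x\<^sub>1, \<dots>, \<phi> x\<^sub>m\<close> up to a factor 2. By Cramer's rule the Lagrange functions at these points
  are bounded by 2, so \<open>\<parallel>f\<parallel>\<^sub>\<infinity> \<le> 2 \<Sum>\<^sub>i |f x\<^sub>i|\<close> (\<open>near_fekete_points\<close>); this bounds every norm at once.
\<close>

text \<open>
  In the sequel, vectors and matrices carry their dimensions explicitly, since the dimension of \<open>V\<close> is a number and not
  a type; the names and symbols of the vectors indexed by a type are set aside.
\<close>

hide_const (open) Finite_Cartesian_Product.vec Finite_Cartesian_Product.mat Determinants.det
  Finite_Cartesian_Product.row Finite_Cartesian_Product.column Determinants.trace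

no_notation vec_nth (infixl "$" 90)

no_notation inner (infix "\<bullet>" 70)

section \<open>Sesquilinear forms on complex coordinate space\<close>

definition hermitian_form :: "nat \<Rightarrow> complex mat \<Rightarrow> bool" where
  "hermitian_form m A \<longleftrightarrow> A \<in> carrier_mat m m \<and>
     (\<forall>x\<in>carrier_vec m. \<forall>y\<in>carrier_vec m. (A *\<^sub>v x) \<bullet>c y = x \<bullet>c (A *\<^sub>v y))"

definition outer :: "nat \<Rightarrow> complex vec \<Rightarrow> complex vec \<Rightarrow> complex mat" where
  "outer m u w = mat m m (\<lambda>(i, j). u $ i * cnj (w $ j))"

lemma cscalar_sum: "y \<in> carrier_vec m \<Longrightarrow> (x :: complex vec) \<bullet>c y = (\<Sum>i<m. x $ i * cnj (y $ i))"
  by (auto simp: scalar_prod_def atLeast0LessThan intro!: sum.cong)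

lemma mult_mat_vec_sum: "A \<in> carrier_mat m m \<Longrightarrow> x \<in> carrier_vec m \<Longrightarrow> i < m \<Longrightarrow>
   (A *\<^sub>v (x :: complex vec)) $ i = (\<Sum>j<m. A $$ (i, j) * x $ j)"
  by (auto simp: scalar_prod_def atLeast0LessThan intro!: sum.cong)

lemma mult_mat_sum: "A \<in> carrier_mat m m \<Longrightarrow> B \<in> carrier_mat m m \<Longrightarrow> i < m \<Longrightarrow> j < m \<Longrightarrow>
   (A * B) $$ (i, j) = (\<Sum>k<m. A $$ (i, k) * (B $$ (k, j) :: complex))"
  by (auto simp: scalar_prod_def atLeast0LessThan intro!: sum.cong)

lemma cscalar_add_left: "x \<in> carrier_vec m \<Longrightarrow> y \<in> carrier_vec m \<Longrightarrow> z \<in> carrier_vec m \<Longrightarrow>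
    (x + y) \<bullet>c (z :: complex vec) = x \<bullet>c z + y \<bullet>c z"
  by (rule add_scalar_prod_distrib[of _ m]) auto

lemma cscalar_minus_left: "x \<in> carrier_vec m \<Longrightarrow> y \<in> carrier_vec m \<Longrightarrow> z \<in> carrier_vec m \<Longrightarrow>
    (x - y) \<bullet>c (z :: complex vec) = x \<bullet>c z - y \<bullet>c z"
  by (rule minus_scalar_prod_distrib[of _ m]) auto

lemma cscalar_smult_left: "x \<in> carrier_vec m \<Longrightarrow> z \<in> carrier_vec m \<Longrightarrow>
    (a \<cdot>\<^sub>v x) \<bullet>c (z :: complex vec) = a * (x \<bullet>c z)"
  by (rule smult_scalar_prod_distrib[of _ m]) auto

lemma cscalar_commute: "x \<in> carrier_vec m \<Longrightarrow> y \<in> carrier_vec m \<Longrightarrow>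
    y \<bullet>c (x :: complex vec) = cnj (x \<bullet>c y)"
  by (simp add: cscalar_sum[of _ m] mult.commute)

lemma cscalar_add_right: "x \<in> carrier_vec m \<Longrightarrow> y \<in> carrier_vec m \<Longrightarrow> z \<in> carrier_vec m \<Longrightarrow>
    z \<bullet>c (x + y :: complex vec) = z \<bullet>c x + z \<bullet>c y"
  by (simp add: cscalar_commute[of "x + y" m z] cscalar_commute[of x m z] cscalar_commute[of y m z] cscalar_add_left[of _ m])

lemma cscalar_minus_right: "x \<in> carrier_vec m \<Longrightarrow> y \<in> carrier_vec m \<Longrightarrow> z \<in> carrier_vec m \<Longrightarrow>
    z \<bullet>c (x - y :: complex vec) = z \<bullet>c x - z \<bullet>c y"
  by (simp add: cscalar_commute[of "x - y" m z] cscalar_commute[of x m z] cscalar_commute[of y m z] cscalar_minus_left[of _ m])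

lemma cscalar_smult_right: "x \<in> carrier_vec m \<Longrightarrow> z \<in> carrier_vec m \<Longrightarrow>
    z \<bullet>c (a \<cdot>\<^sub>v x :: complex vec) = cnj a * (z \<bullet>c x)"
  by (simp add: cscalar_commute[of "a \<cdot>\<^sub>v x" m z] cscalar_commute[of x m z] cscalar_smult_left[of _ m])

lemma smult_mat_mult_vec: "A \<in> carrier_mat m m \<Longrightarrow> x \<in> carrier_vec m \<Longrightarrow>
    (a \<cdot>\<^sub>m A) *\<^sub>v x = (a :: complex) \<cdot>\<^sub>v (A *\<^sub>v x)"
  by (rule eq_vecI) auto

text \<open>
  Instances of the closure rules for matrices of one fixed size: with a single dimension variable they work as
  rewrite rules, whereas the general rules for products have an inner dimension that does not occur in the conclusion.
\<close>

lemma square_mat_closed: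
  "A \<in> carrier_mat m m \<Longrightarrow> B \<in> carrier_mat m m \<Longrightarrow> A * B \<in> carrier_mat m m"
  "A \<in> carrier_mat m m \<Longrightarrow> B \<in> carrier_mat m m \<Longrightarrow> A + B \<in> carrier_mat m m"
  "A \<in> carrier_mat m m \<Longrightarrow> B \<in> carrier_mat m m \<Longrightarrow> A - B \<in> carrier_mat m m"
  "A \<in> carrier_mat m m \<Longrightarrow> a \<cdot>\<^sub>m A \<in> carrier_mat m m"
  "A \<in> carrier_mat m m \<Longrightarrow> x \<in> carrier_vec m \<Longrightarrow> A *\<^sub>v x \<in> carrier_vec m"
  by auto

lemma outer_carrier [simp]: "outer m u w \<in> carrier_mat m m"
  by (simp add: outer_def)

lemma outer_mult_vec:
  "u \<in> carrier_vec m \<Longrightarrow> w \<in> carrier_vec m \<Longrightarrow> x \<in> carrier_vec m \<Longrightarrow> outer m u w *\<^sub>v x = (x \<bullet>c w) \<cdot>\<^sub>v u"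
  by (rule eq_vecI)
    (auto simp: cscalar_sum[of _ m] mult_mat_vec_sum[of _ m] outer_def sum_distrib_left sum_distrib_right ac_simps
      simp del: index_mult_mat_vec intro!: sum.cong)

lemma cscalar_outer:
  assumes "u \<in> carrier_vec m" "x \<in> carrier_vec m"
  shows "(outer m u u *\<^sub>v x) \<bullet>c x = complex_of_real ((cmod (x \<bullet>c u))\<^sup>2)"
  using assms
  by (simp add: outer_mult_vec cscalar_smult_left[of _ m] cscalar_commute[of x m u] complex_norm_square del: of_real_power)

lemma mat_eqI_vec:
  assumes "A \<in> carrier_mat m m" "B \<in> carrier_mat m m"
    "\<And>x :: complex vec. x \<in> carrier_vec m \<Longrightarrow> A *\<^sub>v x = B *\<^sub>v x"
  shows "A = B"
proof (rule eq_matI)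
  fix i j assume ij: "i < dim_row B" "j < dim_col B"
  have "(A *\<^sub>v unit_vec m j) $ i = (B *\<^sub>v unit_vec m j) $ i" using assms(3)[of "unit_vec m j"] by simp
  thus "A $$ (i, j) = B $$ (i, j)" using assms(1,2) ij by simp
qed (use assms in auto)

lemma hermitian_formD:
  assumes "hermitian_form m A"
  shows "A \<in> carrier_mat m m"
    "x \<in> carrier_vec m \<Longrightarrow> y \<in> carrier_vec m \<Longrightarrow> (A *\<^sub>v x) \<bullet>c y = x \<bullet>c (A *\<^sub>v y)"
  using assms by (auto simp: hermitian_form_def)

lemma hermitian_formI:
  assumes A: "A \<in> carrier_mat m m" and sym: "\<And>i j. i < m \<Longrightarrow> j < m \<Longrightarrow> A $$ (j, i) = cnj (A $$ (i, j))"
  shows "hermitian_form m A"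
  unfolding hermitian_form_def
proof (intro conjI ballI A)
  fix x y :: "complex vec" assume x: "x \<in> carrier_vec m" and y: "y \<in> carrier_vec m"
  have "(A *\<^sub>v x) \<bullet>c y = (\<Sum>i<m. \<Sum>j<m. A $$ (i, j) * x $ j * cnj (y $ i))"
    using A x y by (simp add: cscalar_sum[of _ m] mult_mat_vec_sum[of _ m] sum_distrib_right del: index_mult_mat_vec)
  also have "\<dots> = (\<Sum>j<m. \<Sum>i<m. A $$ (i, j) * x $ j * cnj (y $ i))" by (rule sum.swap)
  also have "\<dots> = (\<Sum>j<m. \<Sum>i<m. x $ j * (cnj (A $$ (j, i)) * cnj (y $ i)))"
  proof (intro sum.cong refl)
    fix i j assume "j \<in> {..<m}" "i \<in> {..<m}"
    hence "A $$ (i, j) = cnj (A $$ (j, i))" by (intro sym) auto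
    thus "A $$ (i, j) * x $ j * cnj (y $ i) = x $ j * (cnj (A $$ (j, i)) * cnj (y $ i))"
      by (simp only: mult.assoc mult.commute mult.left_commute)
  qed
  also have "\<dots> = x \<bullet>c (A *\<^sub>v y)"
    using A x y square_mat_closed(5)[OF A y]
    by (simp add: cscalar_sum[of _ m] mult_mat_vec_sum[of _ m] sum_distrib_left del: index_mult_mat_vec)
  finally show "(A *\<^sub>v x) \<bullet>c y = x \<bullet>c (A *\<^sub>v y)" .
qed

lemma hermitian_form_real:
  assumes "hermitian_form m A" "x \<in> carrier_vec m"
  shows "(A *\<^sub>v x) \<bullet>c x = complex_of_real (Re ((A *\<^sub>v x) \<bullet>c x))"
proof -
  have A: "A *\<^sub>v x \<in> carrier_vec m" using hermitian_formD(1)[OF assms(1)] assms(2) by auto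
  have "(A *\<^sub>v x) \<bullet>c x = cnj ((A *\<^sub>v x) \<bullet>c x)"
    using hermitian_formD(2)[OF assms(1,2,2)] cscalar_commute[OF A assms(2)] by simp
  thus ?thesis by (metis Reals_cnj_iff of_real_Re)
qed

lemma hermitian_outer:
  assumes "u \<in> carrier_vec m"
  shows "hermitian_form m (outer m u u)"
  using assms unfolding hermitian_form_def
  by (auto simp: outer_mult_vec cscalar_smult_left[of _ m] cscalar_smult_right[of _ m] cscalar_commute[of u m] mult.commute)

lemma hermitian_add:
  assumes "hermitian_form m A" "hermitian_form m B"
  shows "hermitian_form m (A + B)"
  using assms unfolding hermitian_form_def
  by (auto simp: add_mult_distrib_mat_vec[of _ m m] cscalar_add_left[of _ m] cscalar_add_right[of _ m])

lemma hermitian_smult: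
  assumes "hermitian_form m A"
  shows "hermitian_form m (complex_of_real a \<cdot>\<^sub>m A)"
  using assms unfolding hermitian_form_def
  by (auto simp: smult_mat_mult_vec[of _ m] cscalar_smult_left[of _ m] cscalar_smult_right[of _ m])

lemma hermitian_minus:
  assumes "hermitian_form m A" "hermitian_form m B"
  shows "hermitian_form m (A - B)"
  using assms unfolding hermitian_form_def
  by (auto simp: minus_mult_distrib_mat_vec[of _ m m] cscalar_minus_left[of _ m] cscalar_minus_right[of _ m])

section \<open>Positive definite forms and their inverses\<close>

definition positive_form :: "nat \<Rightarrow> complex mat \<Rightarrow> bool" where
  "positive_form m A \<longleftrightarrow> hermitian_form m A \<and>
     (\<forall>x\<in>carrier_vec m. x \<noteq> 0\<^sub>v m \<longrightarrow> 0 < Re ((A *\<^sub>v x) \<bullet>c x))"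

lemma positive_form_nonneg:
  assumes "positive_form m A" "x \<in> carrier_vec m"
  shows "0 \<le> Re ((A *\<^sub>v x) \<bullet>c x)"
proof (cases "x = 0\<^sub>v m")
  case True
  have "A *\<^sub>v x \<in> carrier_vec m" using assms hermitian_formD(1) positive_form_def by fastforce
  then show ?thesis using True by (simp add: cscalar_sum[of _ m])
next
  case False
  then show ?thesis using assms unfolding positive_form_def by force
qed

lemma positive_form_smult:
  assumes "positive_form m A" "0 < a"
  shows "positive_form m (complex_of_real a \<cdot>\<^sub>m A)"
  using assms hermitian_formD(1)[of m A] unfolding positive_form_def
  by (auto intro!: hermitian_smult simp: smult_mat_mult_vec[of _ m] cscalar_smult_left[of _ m] square_mat_closed)

lemma positive_form_det:
  assumes "positive_form m A"
  shows "det A \<noteq> 0"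
proof
  have A: "A \<in> carrier_mat m m" using assms by (simp add: positive_form_def hermitian_form_def)
  assume "det A = 0"
  then obtain x where x: "x \<in> carrier_vec m" "x \<noteq> 0\<^sub>v m" "A *\<^sub>v x = 0\<^sub>v m"
    using det_0_iff_vec_prod_zero[OF A] by auto
  have "0 < Re ((A *\<^sub>v x) \<bullet>c x)" using assms x by (auto simp: positive_form_def)
  thus False using x by (simp add: cscalar_sum[of _ m])
qed

definition inverse_mats :: "nat \<Rightarrow> complex mat \<Rightarrow> complex mat \<Rightarrow> bool" where
  "inverse_mats m A R \<longleftrightarrow> A \<in> carrier_mat m m \<and> R \<in> carrier_mat m m \<and> A * R = 1\<^sub>m m \<and> R * A = 1\<^sub>m m"

lemma inverse_matsD:
  assumes "inverse_mats m A R"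
  shows "A \<in> carrier_mat m m" "R \<in> carrier_mat m m" "A * R = 1\<^sub>m m" "R * A = 1\<^sub>m m"
    "x \<in> carrier_vec m \<Longrightarrow> A *\<^sub>v (R *\<^sub>v x) = x" "x \<in> carrier_vec m \<Longrightarrow> R *\<^sub>v (A *\<^sub>v x) = x"
proof -
  show *: "A \<in> carrier_mat m m" "R \<in> carrier_mat m m" "A * R = 1\<^sub>m m" "R * A = 1\<^sub>m m"
    using assms by (auto simp: inverse_mats_def)
  show "A *\<^sub>v (R *\<^sub>v x) = x" if "x \<in> carrier_vec m"
    using assoc_mult_mat_vec[OF *(1,2) that] *(3) that by simp
  show "R *\<^sub>v (A *\<^sub>v x) = x" if "x \<in> carrier_vec m"
    using assoc_mult_mat_vec[OF *(2,1) that] *(4) that by simp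
qed

lemma exists_inverse:
  assumes "A \<in> carrier_mat m m" "det A \<noteq> 0"
  shows "\<exists>R. inverse_mats m A R"
proof -
  note adj = adj_mat[OF assms(1)]
  let ?R = "(1 / det A) \<cdot>\<^sub>m adj_mat A"
  have one: "(1 / det A) \<cdot>\<^sub>m (det A \<cdot>\<^sub>m 1\<^sub>m m) = 1\<^sub>m m"
    using assms(2) by (intro eq_matI) auto
  have "A * ?R = (1 / det A) \<cdot>\<^sub>m (A * adj_mat A)"
    by (rule mult_smult_distrib[OF assms(1) adj(1)])
  moreover have "?R * A = (1 / det A) \<cdot>\<^sub>m (adj_mat A * A)"
    by (rule mult_smult_assoc_mat[OF adj(1) assms(1)])
  moreover have "?R \<in> carrier_mat m m" using adj(1) by simp
  ultimately have "inverse_mats m A ?R" using adj one assms unfolding inverse_mats_def by simp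
  thus ?thesis ..
qed

lemma inverse_mats_smult:
  assumes "inverse_mats m A R" "a \<noteq> 0"
  shows "inverse_mats m (a \<cdot>\<^sub>m A) ((1 / a) \<cdot>\<^sub>m R)"
proof -
  note R = inverse_matsD[OF assms(1)]
  have one: "a \<cdot>\<^sub>m ((1 / a) \<cdot>\<^sub>m 1\<^sub>m m) = 1\<^sub>m m" using assms(2) by (intro eq_matI) auto
  have c: "(1 / a) \<cdot>\<^sub>m R \<in> carrier_mat m m" "a \<cdot>\<^sub>m A \<in> carrier_mat m m" using R by auto
  have "(a \<cdot>\<^sub>m A) * ((1 / a) \<cdot>\<^sub>m R) = 1\<^sub>m m"
    using mult_smult_assoc_mat[OF R(1) c(1)] mult_smult_distrib[OF R(1,2)] R(3) one by simp
  thus ?thesis using mat_mult_left_right_inverse[OF c(2,1)] c unfolding inverse_mats_def by simp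
qed

lemma hermitian_inverse:
  assumes "inverse_mats m A R" "hermitian_form m A"
  shows "hermitian_form m R"
proof -
  note [simp] = inverse_matsD[OF assms(1)]
  have "(R *\<^sub>v x) \<bullet>c y = x \<bullet>c (R *\<^sub>v y)" if "x \<in> carrier_vec m" "y \<in> carrier_vec m" for x y
  proof -
    have c: "R *\<^sub>v x \<in> carrier_vec m" "R *\<^sub>v y \<in> carrier_vec m"
      using that mult_mat_vec_carrier[of R m m] by simp_all
    show ?thesis using hermitian_formD(2)[OF assms(2) c] that by simp
  qed
  thus ?thesis by (auto simp: hermitian_form_def)
qed

lemma inverse_nonneg:
  assumes "inverse_mats m A R" "positive_form m A" "x \<in> carrier_vec m"
  shows "0 \<le> Re ((R *\<^sub>v x) \<bullet>c x)"
proof -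
  note [simp] = inverse_matsD[OF assms(1)]
  have c: "R *\<^sub>v x \<in> carrier_vec m" using assms(3) mult_mat_vec_carrier[of R m m] by simp
  have "(R *\<^sub>v x) \<bullet>c x = (A *\<^sub>v (R *\<^sub>v x)) \<bullet>c (R *\<^sub>v x)"
    using hermitian_formD(2)[of m A "R *\<^sub>v x" "R *\<^sub>v x"] c assms by (simp add: positive_form_def)
  thus ?thesis using positive_form_nonneg[OF assms(2) c] by simp
qed

text \<open>
  Only semidefiniteness is assumed, because the lemma also serves to show that a nonsingular semidefinite
  form is definite.
\<close>

lemma cauchy_schwarz_form:
  assumes A: "hermitian_form m A" and nn: "\<And>z. z \<in> carrier_vec m \<Longrightarrow> 0 \<le> Re ((A *\<^sub>v z) \<bullet>c z)"
    and x: "x \<in> carrier_vec m" and y: "y \<in> carrier_vec m"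
  shows "(cmod ((A *\<^sub>v x) \<bullet>c y))\<^sup>2 \<le> Re ((A *\<^sub>v x) \<bullet>c x) * Re ((A *\<^sub>v y) \<bullet>c y)"
proof -
  note Ac = hermitian_formD(1)[OF A]
  define a where "a = Re ((A *\<^sub>v x) \<bullet>c x)"
  define b where "b = Re ((A *\<^sub>v y) \<bullet>c y)"
  define g where "g = (A *\<^sub>v x) \<bullet>c y"
  have Ax: "A *\<^sub>v x \<in> carrier_vec m" and Ay: "A *\<^sub>v y \<in> carrier_vec m" using Ac x y by auto
  have yx: "(A *\<^sub>v y) \<bullet>c x = cnj g"
    unfolding g_def using hermitian_formD(2)[OF A y x] cscalar_commute[OF Ax y] by simp
  have q: "0 \<le> a - 2 * t * (cmod g)\<^sup>2 + t\<^sup>2 * (cmod g)\<^sup>2 * b" for t :: real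
  proof -
    let ?s = "complex_of_real t * g"
    let ?z = "x - ?s \<cdot>\<^sub>v y"
    have z: "?z \<in> carrier_vec m" using x y by auto
    have "(A *\<^sub>v ?z) \<bullet>c ?z = (A *\<^sub>v x) \<bullet>c x - cnj ?s * g - ?s * cnj g + ?s * cnj ?s * ((A *\<^sub>v y) \<bullet>c y)"
      using x y Ac Ax Ay
      by (simp add: mult_minus_distrib_mat_vec[of _ m m] mult_mat_vec[of _ m m] cscalar_minus_left[of _ m]
         cscalar_minus_right[of _ m] cscalar_smult_left[of _ m] cscalar_smult_right[of _ m] yx g_def[symmetric] algebra_simps)
    also have "\<dots> = complex_of_real (a - 2 * t * (cmod g)\<^sup>2 + t\<^sup>2 * (cmod g)\<^sup>2 * b)"
    proof -
      have "(A *\<^sub>v x) \<bullet>c x = complex_of_real a" "(A *\<^sub>v y) \<bullet>c y = complex_of_real b"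
        using hermitian_form_real[OF A x] hermitian_form_real[OF A y] by (simp_all add: a_def b_def)
      moreover have "complex_of_real (cmod g) * complex_of_real (cmod g) = g * cnj g"
        using complex_norm_square[of g] by (simp add: power2_eq_square)
      hence "complex_of_real ((cmod g)\<^sup>2) = g * cnj g" by (simp add: power2_eq_square)
      ultimately show ?thesis
        by (simp add: power2_eq_square[of t] algebra_simps del: of_real_power)
    qed
    finally show ?thesis using nn[OF z] by simp
  qed
  have ab: "0 \<le> a" "0 \<le> b" using nn x y by (auto simp: a_def b_def)
  show ?thesis unfolding a_def[symmetric] b_def[symmetric] g_def[symmetric]
  proof (cases "b = 0")
    case True
    show "(cmod g)\<^sup>2 \<le> a * b"
    proof (rule ccontr)
      assume "\<not> ?thesis"
      hence g: "(cmod g)\<^sup>2 > 0" using True by simp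
      have "0 \<le> a - 2 * (a + 1)" using q[of "(a + 1) / (cmod g)\<^sup>2"] True g by simp
      thus False using ab(1) by simp
    qed
  next
    case False
    have "0 \<le> a - (cmod g)\<^sup>2 / b"
      using q[of "1 / b"] False by (simp add: power2_eq_square field_simps)
    thus "(cmod g)\<^sup>2 \<le> a * b" using False ab by (simp add: field_simps)
  qed
qed

text \<open>
  Cauchy--Schwarz for the inner product given by \<open>B\<close>, applied to \<open>c\<close> and \<open>R v\<close>: the inverse measures the norm of
  the functional \<open>\<langle>\<cdot>, v\<rangle>\<close> with respect to \<open>B\<close>.
\<close>

lemma dual_cauchy_schwarz:
  assumes B: "positive_form m B" and inv: "inverse_mats m B R" and v: "v \<in> carrier_vec m" and c: "c \<in> carrier_vec m"
  shows "(cmod (c \<bullet>c v))\<^sup>2 \<le> Re ((R *\<^sub>v v) \<bullet>c v) * Re ((B *\<^sub>v c) \<bullet>c c)"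
proof -
  note R = inverse_matsD[OF inv]
  have hB: "hermitian_form m B" using B by (simp add: positive_form_def)
  have Rv: "R *\<^sub>v v \<in> carrier_vec m" using R(2) v by auto
  have "(cmod ((B *\<^sub>v (R *\<^sub>v v)) \<bullet>c c))\<^sup>2 \<le> Re ((B *\<^sub>v (R *\<^sub>v v)) \<bullet>c (R *\<^sub>v v)) * Re ((B *\<^sub>v c) \<bullet>c c)"
    by (rule cauchy_schwarz_form[OF hB positive_form_nonneg[OF B] Rv c])
  also have "Re ((B *\<^sub>v (R *\<^sub>v v)) \<bullet>c (R *\<^sub>v v)) = Re ((R *\<^sub>v v) \<bullet>c v)"
    using R(5)[OF v] cscalar_commute[OF Rv v] by simp
  finally show ?thesis using R(5)[OF v] cscalar_commute[OF v c] by simp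
qed

section \<open>Averages of rank-one matrices\<close>

text \<open>
  The real part of the trace of \<open>H G\<close>. For \<open>G\<close> the expectation of \<open>v v\<^sup>*\<close>, it is the expectation of the real
  part of \<open>v\<^sup>* H v\<close>.
\<close>

definition pairing :: "complex mat \<Rightarrow> complex mat \<Rightarrow> real" where
  "pairing H G = Re (\<Sum>i<dim_row H. \<Sum>j<dim_col H. H $$ (i, j) * G $$ (j, i))"

text \<open>
  This says that no real linear functional separates \<open>G\<close> from the matrices \<open>v v\<^sup>*\<close> with \<open>v \<in> S\<close>, that is, \<open>G\<close>
  lies in their closed convex hull. The dual formulation covers sums and integrals alike, and it is
  literally the existence statement that a selection by averaging needs.
\<close>

definition averages_to :: "nat \<Rightarrow> complex vec set \<Rightarrow> complex mat \<Rightarrow> bool" where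
  "averages_to m S G \<longleftrightarrow> (\<forall>H\<in>carrier_mat m m. \<exists>v\<in>S. pairing H G \<le> Re ((H *\<^sub>v v) \<bullet>c v))"

lemma pairing_add: "A \<in> carrier_mat m m \<Longrightarrow> B \<in> carrier_mat m m \<Longrightarrow> pairing (A + B) G = pairing A G + pairing B G"
  by (auto simp: pairing_def sum.distrib algebra_simps)

lemma pairing_minus: "A \<in> carrier_mat m m \<Longrightarrow> B \<in> carrier_mat m m \<Longrightarrow> pairing (A - B) G = pairing A G - pairing B G"
  by (auto simp: pairing_def sum_subtractf algebra_simps)

lemma pairing_smult: "A \<in> carrier_mat m m \<Longrightarrow> pairing (complex_of_real a \<cdot>\<^sub>m A) G = a * pairing A G"
  by (simp add: pairing_def sum_distrib_left mult.assoc)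

lemma pairing_outer:
  assumes "G \<in> carrier_mat m m" "u \<in> carrier_vec m"
  shows "pairing (outer m u u) G = Re ((G *\<^sub>v u) \<bullet>c u)"
proof -
  have "(G *\<^sub>v u) \<bullet>c u = (\<Sum>i<m. \<Sum>j<m. (G $$ (i, j) * u $ j) * cnj (u $ i))"
    using assms by (simp add: cscalar_sum[of _ m] mult_mat_vec_sum[of _ m] sum_distrib_right del: index_mult_mat_vec)
  also have "\<dots> = (\<Sum>j<m. \<Sum>i<m. (G $$ (i, j) * u $ j) * cnj (u $ i))"
    by (rule sum.swap)
  finally show ?thesis
    by (simp add: pairing_def outer_def ac_simps)
qed

lemma pairing_add_right: "H \<in> carrier_mat m m \<Longrightarrow> A \<in> carrier_mat m m \<Longrightarrow> B \<in> carrier_mat m m \<Longrightarrow>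
    pairing H (A + B) = pairing H A + pairing H B"
  by (auto simp: pairing_def sum.distrib algebra_simps)

lemma pairing_smult_right: "H \<in> carrier_mat m m \<Longrightarrow> A \<in> carrier_mat m m \<Longrightarrow>
    pairing H (complex_of_real a \<cdot>\<^sub>m A) = a * pairing H A"
  by (simp add: pairing_def sum_distrib_left mult.assoc mult.left_commute)

lemma pairing_outer_right:
  assumes H: "H \<in> carrier_mat m m" and u: "u \<in> carrier_vec m"
  shows "pairing H (outer m u u) = Re ((H *\<^sub>v u) \<bullet>c u)"
  using assms
  by (simp add: pairing_def outer_def cscalar_sum[of _ m] mult_mat_vec_sum[of _ m] sum_distrib_right mult.assoc del: index_mult_mat_vec)

lemma pairing_inverse:
  assumes "inverse_mats m G R"
  shows "pairing R G = real m"
proof -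
  note R = inverse_matsD[OF assms]
  have "pairing R G = Re (\<Sum>i<m. (R * G) $$ (i, i))"
    using R(1,2) by (simp add: pairing_def mult_mat_sum[of _ m] del: index_mult_mat(1))
  also have "\<dots> = real m" using R(4) by simp
  finally show ?thesis .
qed

lemma averages_to_nonneg:
  assumes "averages_to m S G" "H \<in> carrier_mat m m" "\<And>v. v \<in> S \<Longrightarrow> 0 \<le> Re ((H *\<^sub>v v) \<bullet>c v)"
    "S \<subseteq> carrier_vec m"
  shows "0 \<le> pairing H G"
proof -
  have "complex_of_real (-1) \<cdot>\<^sub>m H \<in> carrier_mat m m" using assms by auto
  then obtain v where v: "v \<in> S" "pairing (complex_of_real (-1) \<cdot>\<^sub>m H) G \<le> Re (((complex_of_real (-1) \<cdot>\<^sub>m H) *\<^sub>v v) \<bullet>c v)"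
    using assms(1) unfolding averages_to_def by blast
  have "v \<in> carrier_vec m" using v assms by auto
  with v(2) assms(2) have "- pairing H G \<le> - Re ((H *\<^sub>v v) \<bullet>c v)"
    by (simp add: pairing_smult[of _ m] smult_mat_mult_vec[of _ m] cscalar_smult_left[of _ m] del: of_real_minus)
  with assms(3)[OF v(1)] show ?thesis by linarith
qed

lemma averages_to_outer:
  assumes "v \<in> S" "v \<in> carrier_vec m"
  shows "averages_to m S (outer m v v)"
  unfolding averages_to_def using assms by (auto intro!: bexI[of _ v] simp: pairing_outer_right)

lemma averages_to_mix:
  assumes A: "averages_to m S A" "A \<in> carrier_mat m m" and B: "averages_to m S B" "B \<in> carrier_mat m m"
    and t: "0 \<le> t" "t \<le> 1"
  shows "averages_to m S (complex_of_real (1 - t) \<cdot>\<^sub>m A + complex_of_real t \<cdot>\<^sub>m B)"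
  unfolding averages_to_def
proof
  fix H :: "complex mat" assume H: "H \<in> carrier_mat m m"
  have eq: "pairing H (complex_of_real (1 - t) \<cdot>\<^sub>m A + complex_of_real t \<cdot>\<^sub>m B) = (1 - t) * pairing H A + t * pairing H B"
    using H A(2) B(2) pairing_smult_right[OF H A(2), of "1 - t"]
    by (simp add: pairing_add_right[of _ m] pairing_smult_right[of _ m] square_mat_closed del: of_real_diff)
  obtain x where x: "x \<in> S" "pairing H A \<le> Re ((H *\<^sub>v x) \<bullet>c x)" using A(1) H unfolding averages_to_def by blast
  obtain y where y: "y \<in> S" "pairing H B \<le> Re ((H *\<^sub>v y) \<bullet>c y)" using B(1) H unfolding averages_to_def by blast
  have "(1 - t) * pairing H A + t * pairing H B \<le> max (pairing H A) (pairing H B)"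
    using t by (intro convex_bound_le) auto
  thus "\<exists>v\<in>S. pairing H (complex_of_real (1 - t) \<cdot>\<^sub>m A + complex_of_real t \<cdot>\<^sub>m B) \<le> Re ((H *\<^sub>v v) \<bullet>c v)"
    unfolding eq using x y by (cases "pairing H A \<le> pairing H B") (force simp: max_def)+
qed

text \<open>
  Test \<open>G\<close> against the matrix whose only nonzero entry is the conjugate of the entry in question, at the
  transposed position.
\<close>

lemma averages_to_entry_bound:
  assumes av: "averages_to m S G" and S: "S \<subseteq> carrier_vec m" and K: "\<And>v i. v \<in> S \<Longrightarrow> i < m \<Longrightarrow> cmod (v $ i) \<le> K"
    and ij: "i < m" "j < m"
  shows "cmod (G $$ (i, j)) \<le> K\<^sup>2"
proof -
  define a where "a = cnj (G $$ (i, j))"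
  define H where "H = mat m m (\<lambda>(k, l). if k = j \<and> l = i then a else 0)"
  have H: "H \<in> carrier_mat m m" by (simp add: H_def)
  obtain v where v: "v \<in> S" "pairing H G \<le> Re ((H *\<^sub>v v) \<bullet>c v)" using av H unfolding averages_to_def by blast
  have vc: "v \<in> carrier_vec m" using v S by auto
  have expand: "(if k = j \<and> l = i then a else 0) * z = (if k = j then if l = i then a * z else 0 else 0)" for k l z
    by simp
  have "pairing H G = (cmod (G $$ (i, j)))\<^sup>2"
  proof -
    have "(\<Sum>k<m. \<Sum>l<m. H $$ (k, l) * G $$ (l, k)) = (\<Sum>k<m. if k = j then a * G $$ (i, k) else 0)"
      using ij by (intro sum.cong) (auto simp: H_def expand sum.delta)
    also have "\<dots> = a * G $$ (i, j)" using ij by simp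
    also have "\<dots> = complex_of_real ((cmod (G $$ (i, j)))\<^sup>2)"
      by (subst complex_norm_square) (simp add: a_def mult.commute)
    finally have "(\<Sum>k<m. \<Sum>l<m. H $$ (k, l) * G $$ (l, k)) = complex_of_real ((cmod (G $$ (i, j)))\<^sup>2)" .
    thus ?thesis unfolding pairing_def using carrier_matD[OF H] by (simp only: Re_complex_of_real)
  qed
  moreover have "(H *\<^sub>v v) \<bullet>c v = a * v $ i * cnj (v $ j)"
  proof -
    have "(H *\<^sub>v v) $ k = (if k = j then a * v $ i else 0)" if "k < m" for k
      using ij that vc H by (simp add: mult_mat_vec_sum[of _ m] H_def expand del: index_mult_mat_vec)
    hence "(H *\<^sub>v v) \<bullet>c v = (\<Sum>k<m. if k = j then a * v $ i * cnj (v $ k) else 0)"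
      unfolding cscalar_sum[OF vc] by (intro sum.cong) auto
    thus ?thesis using ij by simp
  qed
  moreover have "Re (a * v $ i * cnj (v $ j)) \<le> cmod a * (K * K)"
  proof -
    have "Re (a * v $ i * cnj (v $ j)) \<le> cmod (a * v $ i * cnj (v $ j))" by (rule complex_Re_le_cmod)
    also have "\<dots> = cmod a * (cmod (v $ i) * cmod (v $ j))" by (simp add: norm_mult mult.assoc)
    also have "\<dots> \<le> cmod a * (K * K)"
      using K[OF v(1)] ij by (intro mult_left_mono mult_mono) (auto intro: order_trans[OF norm_ge_zero])
    finally show ?thesis .
  qed
  ultimately have "cmod (G $$ (i, j)) * cmod (G $$ (i, j)) \<le> cmod (G $$ (i, j)) * K\<^sup>2"
    using v(2) by (simp add: a_def power2_eq_square)
  thus ?thesis by (cases "G $$ (i, j) = 0") auto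
qed

lemma averages_to_positive:
  assumes h: "hermitian_form m G" and av: "averages_to m S G" and S: "S \<subseteq> carrier_vec m"
  shows "c \<in> carrier_vec m \<Longrightarrow> 0 \<le> Re ((G *\<^sub>v c) \<bullet>c c)" "det G \<noteq> 0 \<Longrightarrow> positive_form m G"
proof -
  note G = hermitian_formD(1)[OF h]
  show nn: "0 \<le> Re ((G *\<^sub>v c) \<bullet>c c)" if c: "c \<in> carrier_vec m" for c
  proof -
    have "0 \<le> pairing (outer m c c) G"
    proof (rule averages_to_nonneg[OF av outer_carrier _ S])
      fix v assume "v \<in> S"
      hence "v \<in> carrier_vec m" using S by auto
      thus "0 \<le> Re ((outer m c c *\<^sub>v v) \<bullet>c v)" using cscalar_outer[OF c] by simp
    qed
    thus ?thesis using pairing_outer[OF G c] by simp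
  qed
  show "positive_form m G" if det: "det G \<noteq> 0"
    unfolding positive_form_def
  proof (intro conjI ballI impI h)
    fix x :: "complex vec" assume x: "x \<in> carrier_vec m" "x \<noteq> 0\<^sub>v m"
    obtain R where R: "inverse_mats m G R" using exists_inverse[OF G det] by blast
    define y where "y = R *\<^sub>v x"
    have y: "y \<in> carrier_vec m" "G *\<^sub>v y = x" using inverse_matsD[OF R] x(1) by (auto simp: y_def square_mat_closed(5))
    have Gx: "G *\<^sub>v x \<in> carrier_vec m" using G x by auto
    have "(cmod ((G *\<^sub>v x) \<bullet>c y))\<^sup>2 \<le> Re ((G *\<^sub>v x) \<bullet>c x) * Re ((G *\<^sub>v y) \<bullet>c y)"
      by (rule cauchy_schwarz_form[OF h nn x(1) y(1)])
    moreover have "(G *\<^sub>v x) \<bullet>c y = x \<bullet>c x" using hermitian_formD(2)[OF h x(1) y(1)] y(2) by simp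
    moreover have "x \<bullet>c x \<noteq> 0" using x conjugate_square_eq_0_vec[of x m] by simp
    ultimately have "Re ((G *\<^sub>v x) \<bullet>c x) \<noteq> 0" by auto
    thus "0 < Re ((G *\<^sub>v x) \<bullet>c x)" using nn[OF x(1)] by simp
  qed
qed

section \<open>The lower barrier\<close>

text \<open>
  A potential of at most \<open>\<epsilon>\<close> keeps \<open>B\<close> above \<open>G / \<epsilon>\<close>. By \<open>dual_cauchy_schwarz\<close> the matrix
  \<open>(c\<^sup>* B c) R - c c\<^sup>*\<close> is nonnegative at every \<open>v \<in> S\<close>; now average over \<open>v\<close>.
\<close>

lemma form_le_potential:
  assumes S: "S \<subseteq> carrier_vec m" and av: "averages_to m S G"
    and G: "G \<in> carrier_mat m m" and B: "positive_form m B" and inv: "inverse_mats m B R"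
    and c: "c \<in> carrier_vec m"
  shows "Re ((G *\<^sub>v c) \<bullet>c c) \<le> pairing R G * Re ((B *\<^sub>v c) \<bullet>c c)"
proof -
  note R = inverse_matsD[OF inv]
  have hB: "hermitian_form m B" using B by (simp add: positive_form_def)
  define b where "b = Re ((B *\<^sub>v c) \<bullet>c c)"
  define H where "H = complex_of_real b \<cdot>\<^sub>m R - outer m c c"
  have H: "H \<in> carrier_mat m m" using R(2) by (simp add: H_def minus_carrier_mat)
  have bR: "complex_of_real b \<cdot>\<^sub>m R \<in> carrier_mat m m" using R(2) by simp
  have "0 \<le> pairing H G"
  proof (rule averages_to_nonneg[OF av H _ S])
    fix v assume "v \<in> S"
    hence v: "v \<in> carrier_vec m" using S by auto
    have Rv: "R *\<^sub>v v \<in> carrier_vec m" using R(2) v by auto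
    have "(cmod (v \<bullet>c c))\<^sup>2 \<le> b * Re ((R *\<^sub>v v) \<bullet>c v)"
      using dual_cauchy_schwarz[OF B inv v c] cscalar_commute[OF c v] by (simp add: b_def mult.commute)
    moreover have "(H *\<^sub>v v) \<bullet>c v = complex_of_real b * ((R *\<^sub>v v) \<bullet>c v) - complex_of_real ((cmod (v \<bullet>c c))\<^sup>2)"
      unfolding H_def using v c Rv R(2) cscalar_outer[OF c v] square_mat_closed(5)[OF outer_carrier v, of c c]
      by (simp add: minus_mult_distrib_mat_vec[OF bR outer_carrier v] cscalar_minus_left[of _ m]
          smult_mat_mult_vec[OF R(2) v] cscalar_smult_left[of _ m] del: of_real_power)
    ultimately show "0 \<le> Re ((H *\<^sub>v v) \<bullet>c v)" by (simp del: of_real_power)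
  qed
  also have "pairing H G = b * pairing R G - Re ((G *\<^sub>v c) \<bullet>c c)"
    unfolding H_def using pairing_minus[OF bR outer_carrier] pairing_smult[OF R(2)] pairing_outer[OF G c] by simp
  finally show ?thesis by (simp add: b_def mult.commute)
qed

text \<open>
  One step of the selection. Write \<open>T(H)\<close> for \<open>pairing H G\<close>. Raising the barrier replaces \<open>B\<close> by \<open>B' = B - \<delta> G\<close>
  with inverse \<open>R'\<close> and increases the potential by some \<open>\<Delta>\<close>. Adding \<open>v v\<^sup>*\<close> lowers it by \<open>q / (1 + p)\<close>, where
  \<open>p = v\<^sup>* R' v\<close> and \<open>q = v\<^sup>* R' G R' v\<close> (Sherman--Morrison). So a vector with \<open>q - \<Delta> p \<ge> \<Delta>\<close> is needed, and it
  suffices that this holds on average, that is, \<open>T(R' G R') - \<Delta> T(R') \<ge> \<Delta>\<close>. The choice \<open>\<delta> = 1 / (1 + \<epsilon>)\<close> makes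
  this true.
\<close>

lemma barrier_step:
  assumes S: "S \<subseteq> carrier_vec m" and av: "averages_to m S G" and pG: "positive_form m G"
    and B: "positive_form m B" and inv: "inverse_mats m B R"
    and pot: "pairing R G \<le> \<epsilon>" and eps: "\<epsilon> > 0" and delta: "\<delta> = 1 / (1 + \<epsilon>)"
  shows "\<exists>v\<in>S. \<exists>R'. positive_form m (B - complex_of_real \<delta> \<cdot>\<^sub>m G + outer m v v) \<and>
    inverse_mats m (B - complex_of_real \<delta> \<cdot>\<^sub>m G + outer m v v) R' \<and> pairing R' G \<le> \<epsilon>"
proof -
  note R = inverse_matsD[OF inv]
  have hB: "hermitian_form m B" using B by (simp add: positive_form_def)
  have hG: "hermitian_form m G" using pG by (simp add: positive_form_def)
  note G = hermitian_formD(1)[OF hG]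
  have d: "0 < \<delta>" "\<delta> * \<epsilon> < 1" "\<delta> * (1 + \<epsilon>) = 1" using eps by (auto simp: delta field_simps)
  let ?d = "complex_of_real \<delta>"
  define B' where "B' = B - ?d \<cdot>\<^sub>m G"
  have dG: "?d \<cdot>\<^sub>m G \<in> carrier_mat m m" using G by simp
  have B'c: "B' \<in> carrier_mat m m" unfolding B'_def using G R(1) by (simp add: square_mat_closed)
  have hB': "hermitian_form m B'" unfolding B'_def by (intro hermitian_minus hermitian_smult hB hG)
  have B'form: "Re ((B' *\<^sub>v x) \<bullet>c x) = Re ((B *\<^sub>v x) \<bullet>c x) - \<delta> * Re ((G *\<^sub>v x) \<bullet>c x)" 
    if x: "x \<in> carrier_vec m" for x :: "complex vec"
    unfolding B'_def using x square_mat_closed(5)[OF G x] square_mat_closed(5)[OF R(1) x]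
    by (simp add: minus_mult_distrib_mat_vec[OF R(1) dG x] smult_mat_mult_vec[OF G x]
        cscalar_minus_left[of _ m] cscalar_smult_left[of _ m])
  have B': "positive_form m B'"
    unfolding positive_form_def
  proof (intro conjI ballI impI hB')
    fix x :: "complex vec" assume x: "x \<in> carrier_vec m" "x \<noteq> 0\<^sub>v m"
    define b where "b = Re ((B *\<^sub>v x) \<bullet>c x)"
    have b: "b > 0" using B x by (simp add: positive_form_def b_def)
    have "Re ((G *\<^sub>v x) \<bullet>c x) \<le> pairing R G * b"
      unfolding b_def by (rule form_le_potential[OF S av G B inv x(1)])
    also have "\<dots> \<le> \<epsilon> * b" using pot b by (simp add: mult_right_mono)
    finally have "\<delta> * Re ((G *\<^sub>v x) \<bullet>c x) \<le> \<delta> * (\<epsilon> * b)" using d(1) by (simp add: mult_left_mono)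
    also have "\<dots> < b" using mult_strict_right_mono[OF d(2) b] by (simp add: mult.assoc)
    finally show "0 < Re ((B' *\<^sub>v x) \<bullet>c x)" using B'form[OF x(1)] by (simp add: b_def)
  qed
  obtain R' where inv': "inverse_mats m B' R'"
    using exists_inverse[OF B'c positive_form_det[OF B']] by blast
  note R' = inverse_matsD[OF inv']
  have hR: "hermitian_form m R" by (rule hermitian_inverse[OF inv hB])
  have hR': "hermitian_form m R'" by (rule hermitian_inverse[OF inv' hB'])
  note c = G R(1) R(2) R'(1) R'(2)
  note a = assoc_mult_mat[of _ m m _ m _ m]
  have Bsum: "B = B' + ?d \<cdot>\<^sub>m G" unfolding B'_def using R(1) G by (intro eq_matI) auto
  \<comment> \<open>The resolvent identity in both forms; together they say that \<open>R\<close> and \<open>R'\<close> commute across \<open>G\<close>.\<close>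
  have res1: "R' = R + ?d \<cdot>\<^sub>m (R * (G * R'))"
  proof -
    have "R' = R * (B * R')" using c R by (simp add: a[symmetric])
    also have "B * R' = 1\<^sub>m m + ?d \<cdot>\<^sub>m (G * R')"
      unfolding Bsum using add_mult_distrib_mat[OF R'(1) dG R'(2)] mult_smult_assoc_mat[OF G R'(2)] R'(3) by simp
    also have "R * \<dots> = R + ?d \<cdot>\<^sub>m (R * (G * R'))"
      using c by (simp add: mult_add_distrib_mat[of _ m m _ m] mult_smult_distrib[of _ m m _ m])
    finally show ?thesis .
  qed
  have res2: "R' = R + ?d \<cdot>\<^sub>m (R' * (G * R))"
  proof -
    have "R' = R' * (B * R)" using c R by simp
    also have "B * R = B' * R + ?d \<cdot>\<^sub>m (G * R)"
      unfolding Bsum using add_mult_distrib_mat[OF R'(1) dG R(2)] mult_smult_assoc_mat[OF G R(2)] by simp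
    also have "R' * \<dots> = R' * B' * R + ?d \<cdot>\<^sub>m (R' * (G * R))"
      using c by (simp add: mult_add_distrib_mat[of _ m m _ m] mult_smult_distrib[of _ m m _ m])
    also have "R' * B' * R = R" using R'(4) R(2) by simp
    finally show ?thesis .
  qed
  have comm: "R' * (G * R) = R * (G * R')"
  proof -
    have *: "?d \<cdot>\<^sub>m (R' * (G * R)) = ?d \<cdot>\<^sub>m (R * (G * R'))"
    proof (rule eq_matI)
      fix i j assume "i < dim_row (?d \<cdot>\<^sub>m (R * (G * R')))" "j < dim_col (?d \<cdot>\<^sub>m (R * (G * R')))"
      hence ij: "i < m" "j < m" using c by auto
      have "(R + ?d \<cdot>\<^sub>m (R' * (G * R))) $$ (i, j) = (R + ?d \<cdot>\<^sub>m (R * (G * R'))) $$ (i, j)"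
        using res1 res2 by simp
      thus "(?d \<cdot>\<^sub>m (R' * (G * R))) $$ (i, j) = (?d \<cdot>\<^sub>m (R * (G * R'))) $$ (i, j)"
        using ij c by simp
    qed (use c in auto)
    show ?thesis
    proof (rule eq_matI)
      fix i j assume "i < dim_row (R * (G * R'))" "j < dim_col (R * (G * R'))"
      moreover have "(?d \<cdot>\<^sub>m (R' * (G * R))) $$ (i, j) = (?d \<cdot>\<^sub>m (R * (G * R'))) $$ (i, j)"
        using * by simp
      ultimately show "(R' * (G * R)) $$ (i, j) = (R * (G * R')) $$ (i, j)" using c d(1) by auto
    qed (use c in auto)
  qed
  define T where "T = pairing R G"
  define \<Delta> where "\<Delta> = \<delta> * pairing (R * (G * R')) G"
  define W where "W = pairing (R * (G * (R' * (G * R')))) G"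
  let ?D = "complex_of_real \<Delta>"
  have T': "pairing R' G = T + \<Delta>"
    by (subst res1) (use c in \<open>simp add: pairing_add[of _ m] pairing_smult[of _ m] square_mat_closed T_def \<Delta>_def\<close>)
  have V: "pairing (R' * (G * R')) G = pairing (R * (G * R')) G + \<delta> * W"
  proof -
    have "R' * (G * R') = R * (G * R') + ?d \<cdot>\<^sub>m (R * (G * (R' * (G * R'))))"
      by (subst res1) (use c in \<open>simp add: add_mult_distrib_mat[of _ m m _ _ m] mult_smult_assoc_mat[of _ m m _ m] square_mat_closed a\<close>)
    hence "pairing (R' * (G * R')) G = pairing (R * (G * R') + ?d \<cdot>\<^sub>m (R * (G * (R' * (G * R'))))) G"
      by (rule arg_cong)
    also have "\<dots> = pairing (R * (G * R')) G + \<delta> * W"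
      using c by (simp add: pairing_add[of _ m] pairing_smult[of _ m] square_mat_closed W_def)
    finally show ?thesis .
  qed
  \<comment> \<open>This replaces Cauchy--Schwarz for traces, \<open>T(R G R')\<^sup>2 \<le> T(R) T(R G R' G R')\<close>: the matrix
     \<open>(R' G - \<Delta>) R (G R' - \<Delta>)\<close> is nonnegative, with the free scalar of the discriminant argument set to \<open>\<Delta>\<close>.\<close>
  have CS: "0 \<le> \<Delta>\<^sup>2 * T - 2 * \<Delta> * pairing (R * (G * R')) G + W"
  proof -
    define P where "P = R * (G * R')"
    define Q where "Q = R * (G * (R' * (G * R')))"
    define H where "H = Q - (complex_of_real (2 * \<Delta>) \<cdot>\<^sub>m P) + complex_of_real (\<Delta>\<^sup>2) \<cdot>\<^sub>m R"
    have PQ: "P \<in> carrier_mat m m" "Q \<in> carrier_mat m m" using c by (auto simp: P_def Q_def)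
    have Hc: "H \<in> carrier_mat m m" using c PQ by (simp add: H_def square_mat_closed)
    have "0 \<le> pairing H G"
    proof (rule averages_to_nonneg[OF av Hc _ S])
      fix v assume "v \<in> S"
      hence v: "v \<in> carrier_vec m" using S by auto
      define z where "z = G *\<^sub>v (R' *\<^sub>v v)"
      have z: "z \<in> carrier_vec m" using c v by (simp add: z_def square_mat_closed)
      have Rz: "R *\<^sub>v z \<in> carrier_vec m" "R *\<^sub>v v \<in> carrier_vec m" "R' *\<^sub>v v \<in> carrier_vec m"
        "G *\<^sub>v (R *\<^sub>v z) \<in> carrier_vec m"  "G *\<^sub>v (R *\<^sub>v v) \<in> carrier_vec m" using c z v by (simp_all add: square_mat_closed)
      have Pv: "P *\<^sub>v v = R *\<^sub>v z" using c v by (simp add: P_def z_def assoc_mult_mat_vec[of _ m m _ m] square_mat_closed)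
      have Pv': "P *\<^sub>v v = R' *\<^sub>v (G *\<^sub>v (R *\<^sub>v v))"
        using c v by (simp add: P_def comm[symmetric] assoc_mult_mat_vec[of _ m m _ m] square_mat_closed)
      have "Q = R' * (G * (R * (G * R')))"
      proof -
        have "Q = (R * (G * R')) * (G * R')" using c by (simp add: Q_def a square_mat_closed)
        also have "\<dots> = (R' * (G * R)) * (G * R')" by (simp add: comm)
        finally show ?thesis using c by (simp add: a square_mat_closed)
      qed
      hence Qv: "Q *\<^sub>v v = R' *\<^sub>v (G *\<^sub>v (R *\<^sub>v z))"
        using c v by (simp add: z_def assoc_mult_mat_vec[of _ m m _ m] square_mat_closed)
      have Q1: "(Q *\<^sub>v v) \<bullet>c v = (R *\<^sub>v z) \<bullet>c z"
        unfolding Qv using hermitian_formD(2)[OF hR' Rz(4) v] hermitian_formD(2)[OF hG Rz(1,3)] by (simp add: z_def)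
      have P1: "(P *\<^sub>v v) \<bullet>c v = (R *\<^sub>v z) \<bullet>c v" by (simp add: Pv)
      have P2: "(P *\<^sub>v v) \<bullet>c v = (R *\<^sub>v v) \<bullet>c z"
        unfolding Pv' using hermitian_formD(2)[OF hR' Rz(5) v] hermitian_formD(2)[OF hG Rz(2,3)] by (simp add: z_def)
      define y where "y = z - ?D \<cdot>\<^sub>v v"
      have y: "y \<in> carrier_vec m" using z v by (simp add: y_def)
      have "0 \<le> Re ((R *\<^sub>v y) \<bullet>c y)" by (rule inverse_nonneg[OF inv B y])
      also have "(R *\<^sub>v y) \<bullet>c y = (R *\<^sub>v z) \<bullet>c z - ?D * ((R *\<^sub>v z) \<bullet>c v) - ?D * ((R *\<^sub>v v) \<bullet>c z) + ?D\<^sup>2 * ((R *\<^sub>v v) \<bullet>c v)"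
        using v z c Rz unfolding y_def
        by (simp add: mult_minus_distrib_mat_vec[of _ m m] mult_mat_vec[of _ m m] cscalar_minus_left[of _ m]
         cscalar_minus_right[of _ m] cscalar_smult_left[of _ m] cscalar_smult_right[of _ m] power2_eq_square algebra_simps)
      also have "\<dots> = (Q *\<^sub>v v) \<bullet>c v - complex_of_real (2 * \<Delta>) * ((P *\<^sub>v v) \<bullet>c v) + ?D\<^sup>2 * ((R *\<^sub>v v) \<bullet>c v)"
        using Q1 P1 P2 by (simp add: algebra_simps)
      also have "\<dots> = (H *\<^sub>v v) \<bullet>c v"
        using v c PQ unfolding H_def
        by (simp add: add_mult_distrib_mat_vec[of _ m m] minus_mult_distrib_mat_vec[of _ m m] smult_mat_mult_vec[of _ m]
          cscalar_minus_left[of _ m] cscalar_add_left[of _ m] cscalar_smult_left[of _ m] square_mat_closed)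
      finally show "0 \<le> Re ((H *\<^sub>v v) \<bullet>c v)" .
    qed
    also have "pairing H G = W - 2 * \<Delta> * pairing P G + \<Delta>\<^sup>2 * T"
      unfolding H_def W_def T_def using PQ c pairing_smult[OF PQ(1), of "2 * \<Delta>" G]  pairing_smult[OF R(2), of "\<Delta>\<^sup>2" G]
      by (simp add: pairing_add[of _ m] pairing_minus[of _ m] square_mat_closed Q_def del: of_real_power of_real_mult)
    finally show ?thesis by (simp add: P_def)
  qed
  \<comment> \<open>The average of \<open>q - \<Delta> p\<close> is at least \<open>\<Delta>\<close>.\<close>
  have gain: "\<Delta> \<le> pairing (R' * (G * R')) G - \<Delta> * pairing R' G"
  proof -
    define X where "X = pairing (R * (G * R')) G"
    have DX: "\<Delta> = \<delta> * X" by (simp add: \<Delta>_def X_def)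
    \<comment> \<open>One more use of the resolvent identity turns \<open>R G R'\<close> into a sum of two nonnegative matrices.\<close>
    have nn: "0 \<le> X"
    proof -
      have eq: "R * (G * R') = R * (G * R) + ?d \<cdot>\<^sub>m (R * (G * (R' * (G * R))))"
        by (subst res2) (use c in \<open>simp add: mult_add_distrib_mat[of _ m m _ m] mult_smult_distrib[of _ m m _ m] square_mat_closed\<close>)
      have "0 \<le> pairing (R * (G * R)) G" "0 \<le> pairing (R * (G * (R' * (G * R)))) G"
      proof (rule_tac [!] averages_to_nonneg[OF av _ _ S])
        fix v assume "v \<in> S"
        hence v: "v \<in> carrier_vec m" using S by auto
        have w: "R *\<^sub>v v \<in> carrier_vec m" "G *\<^sub>v (R *\<^sub>v v) \<in> carrier_vec m"
          "R' *\<^sub>v (G *\<^sub>v (R *\<^sub>v v)) \<in> carrier_vec m" "G *\<^sub>v (R' *\<^sub>v (G *\<^sub>v (R *\<^sub>v v))) \<in> carrier_vec m"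
          using c v by (simp_all add: square_mat_closed)
        have "((R * (G * R)) *\<^sub>v v) \<bullet>c v = (G *\<^sub>v (R *\<^sub>v v)) \<bullet>c (R *\<^sub>v v)"
          using c v hermitian_formD(2)[OF hR w(2) v] by (simp add: assoc_mult_mat_vec[of _ m m _ m] square_mat_closed)
        thus "0 \<le> Re (((R * (G * R)) *\<^sub>v v) \<bullet>c v)" using positive_form_nonneg[OF pG w(1)] by simp
        have "((R * (G * (R' * (G * R)))) *\<^sub>v v) \<bullet>c v = (R' *\<^sub>v (G *\<^sub>v (R *\<^sub>v v))) \<bullet>c (G *\<^sub>v (R *\<^sub>v v))"
          using c v hermitian_formD(2)[OF hR w(4) v] hermitian_formD(2)[OF hG w(3,1)]
          by (simp add: assoc_mult_mat_vec[of _ m m _ m] square_mat_closed)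
        thus "0 \<le> Re (((R * (G * (R' * (G * R)))) *\<^sub>v v) \<bullet>c v)"
          using inverse_nonneg[OF inv' B' w(2)] by simp
      qed (use c in auto)
      thus ?thesis unfolding X_def eq using c d(1) by (simp add: pairing_add[of _ m] pairing_smult[of _ m] square_mat_closed)
    qed
    have "0 \<le> \<delta> * (\<Delta>\<^sup>2 * T - 2 * \<Delta> * X + W)" using CS d(1) by (simp add: X_def)
    hence "\<delta> * W \<ge> 2 * \<Delta>\<^sup>2 - \<delta> * \<Delta>\<^sup>2 * T"
      by (simp add: DX power2_eq_square algebra_simps)
    moreover have "X * (1 - \<delta> * T - \<delta>) \<ge> 0"
    proof (intro mult_nonneg_nonneg nn)
      have "\<delta> * T \<le> \<delta> * \<epsilon>" using pot d(1) by (simp add: T_def)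
      thus "0 \<le> 1 - \<delta> * T - \<delta>" using d(3) by (simp add: algebra_simps)
    qed
    moreover have "\<Delta>\<^sup>2 * (1 - \<delta> * T) \<ge> 0"
    proof (intro mult_nonneg_nonneg)
      have "\<delta> * T \<le> \<delta> * \<epsilon>" using pot d(1) by (simp add: T_def)
      thus "0 \<le> 1 - \<delta> * T" using d(2) by simp
    qed simp
    ultimately have "X + \<delta> * W - \<Delta> * (T + \<Delta>) - \<Delta> \<ge> 0"
      by (simp add: DX power2_eq_square algebra_simps)
    thus ?thesis unfolding V T' X_def by simp
  qed
  define H where "H = R' * (G * R') - ?D \<cdot>\<^sub>m R'"
  have Hc: "H \<in> carrier_mat m m" using c by (simp add: H_def square_mat_closed)
  obtain v where vS: "v \<in> S" and pv: "pairing H G \<le> Re ((H *\<^sub>v v) \<bullet>c v)"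
    using av Hc unfolding averages_to_def by blast
  have v: "v \<in> carrier_vec m" using vS S by auto
  define u where "u = R' *\<^sub>v v"
  have u: "u \<in> carrier_vec m" "G *\<^sub>v u \<in> carrier_vec m" using v c by (auto simp: u_def)
  define p where "p = Re (u \<bullet>c v)"
  define q where "q = Re ((G *\<^sub>v u) \<bullet>c u)"
  have p0: "0 \<le> p" unfolding p_def u_def by (rule inverse_nonneg[OF inv' B' v])
  have uv: "u \<bullet>c v = complex_of_real p" unfolding p_def u_def by (rule hermitian_form_real[OF hR' v])
  have qp: "\<Delta> * (1 + p) \<le> q"
  proof -
    have "(H *\<^sub>v v) \<bullet>c v = (R' *\<^sub>v (G *\<^sub>v u)) \<bullet>c v - ?D * (u \<bullet>c v)"
      unfolding H_def using v u c
      by (simp add: minus_mult_distrib_mat_vec[of _ m m] smult_mat_mult_vec[of _ m] cscalar_minus_left[of _ m]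
          cscalar_smult_left[of _ m] square_mat_closed assoc_mult_mat_vec[of _ m m _ m] square_mat_closed u_def[symmetric])
    also have "(R' *\<^sub>v (G *\<^sub>v u)) \<bullet>c v = (G *\<^sub>v u) \<bullet>c u"
      using hermitian_formD(2)[OF hR' u(2) v] by (simp add: u_def)
    finally have "Re ((H *\<^sub>v v) \<bullet>c v) = q - \<Delta> * p" by (simp add: q_def p_def)
    moreover have "pairing H G = pairing (R' * (G * R')) G - \<Delta> * pairing R' G"
      using c by (simp add: H_def pairing_minus[of _ m] pairing_smult[of _ m] square_mat_closed)
    ultimately show ?thesis using pv gain by (simp add: algebra_simps)
  qed
  \<comment> \<open>Sherman--Morrison\<close>
  define R2 where "R2 = R' - complex_of_real (1 / (1 + p)) \<cdot>\<^sub>m outer m u u"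
  have R2c: "R2 \<in> carrier_mat m m" using R'(2) by (simp add: R2_def square_mat_closed)
  let ?B2 = "B' + outer m v v"
  have B2: "positive_form m ?B2"
    unfolding positive_form_def
  proof (intro conjI ballI impI)
    show "hermitian_form m ?B2" by (intro hermitian_add hB' hermitian_outer v)
    fix x :: "complex vec" assume x: "x \<in> carrier_vec m" "x \<noteq> 0\<^sub>v m"
    have "Re ((?B2 *\<^sub>v x) \<bullet>c x) = Re ((B' *\<^sub>v x) \<bullet>c x) + (cmod (x \<bullet>c v))\<^sup>2"
      using x v c cscalar_outer[OF v x(1)]
      by (simp add: add_mult_distrib_mat_vec[of _ m m] cscalar_add_left[of _ m] square_mat_closed del: of_real_power)
    thus "0 < Re ((?B2 *\<^sub>v x) \<bullet>c x)" using B' x unfolding positive_form_def by (smt (verit) zero_le_power2)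
  qed
  have inv2: "inverse_mats m ?B2 R2"
  proof -
    have Bu: "B' *\<^sub>v u = v" using R'(5)[OF v] by (simp add: u_def)
    have B2c: "?B2 \<in> carrier_mat m m" using c by simp
    have "?B2 * R2 = 1\<^sub>m m"
    proof (rule mat_eqI_vec)
      fix x :: "complex vec" assume x: "x \<in> carrier_vec m"
      define s where "s = complex_of_real (1 / (1 + p)) * (x \<bullet>c u)"
      have sv: "(x \<bullet>c u) = s + s * complex_of_real p"
      proof -
        have "complex_of_real (1 / (1 + p)) * complex_of_real (1 + p) = 1"
          using p0 unfolding of_real_mult[symmetric] by simp
        hence "s * complex_of_real (1 + p) = x \<bullet>c u"
          unfolding s_def by (metis mult.assoc mult.commute mult.left_neutral)
        thus ?thesis by (simp add: algebra_simps)
      qed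
      have R'x: "R' *\<^sub>v x \<in> carrier_vec m" using c x by auto
      have "(R' *\<^sub>v x) \<bullet>c v = x \<bullet>c u" using hermitian_formD(2)[OF hR' x v] by (simp add: u_def)
      have R2x: "R2 *\<^sub>v x = R' *\<^sub>v x - s \<cdot>\<^sub>v u"
        unfolding R2_def s_def using x u c
        by (simp add: minus_mult_distrib_mat_vec[of _ m m] smult_mat_mult_vec[of _ m] outer_mult_vec smult_smult_assoc)
      have "(?B2 * R2) *\<^sub>v x = ?B2 *\<^sub>v (R2 *\<^sub>v x)"
        using R2c c x by (intro assoc_mult_mat_vec[of _ m m _ m]) auto
      also have "\<dots> = B' *\<^sub>v (R2 *\<^sub>v x) + ((R2 *\<^sub>v x) \<bullet>c v) \<cdot>\<^sub>v v"
        using R2c c x v by (simp add: add_mult_distrib_mat_vec[of _ m m] outer_mult_vec square_mat_closed)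
      also have "B' *\<^sub>v (R2 *\<^sub>v x) = x - s \<cdot>\<^sub>v v"
        unfolding R2x using c x u R'x R'(5)[OF x] Bu by (simp add: mult_minus_distrib_mat_vec[of _ m m] mult_mat_vec[of _ m m])
      also have "(R2 *\<^sub>v x) \<bullet>c v = s"
        unfolding R2x using R'x u v uv sv \<open>(R' *\<^sub>v x) \<bullet>c v = x \<bullet>c u\<close>
        by (simp add: cscalar_minus_left[of _ m] cscalar_smult_left[of _ m])
      also have "x - s \<cdot>\<^sub>v v + s \<cdot>\<^sub>v v = 1\<^sub>m m *\<^sub>v x" using x v by (intro eq_vecI) auto
      finally show "(?B2 * R2) *\<^sub>v x = 1\<^sub>m m *\<^sub>v x" .
    qed (use R2c B2c in \<open>simp_all add: square_mat_closed\<close>)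
    thus ?thesis using mat_mult_left_right_inverse[of ?B2 m R2] R2c B2c unfolding inverse_mats_def by auto
  qed
  have "pairing R2 G = T + \<Delta> - (1 / (1 + p)) * q"
    unfolding R2_def q_def T'[symmetric]
    using pairing_smult[OF outer_carrier, of "1 / (1 + p)" m u u G] pairing_outer[OF G u(1)] c
    by (simp add: pairing_minus[of _ m])
  also have "\<dots> \<le> T" using qp p0 by (simp add: field_simps)
  finally have "pairing R2 G \<le> \<epsilon>" using pot by (simp add: T_def)
  with vS B2 inv2 show ?thesis unfolding B'_def by blast
qed

text \<open>
  The initial level \<open>-m / \<epsilon>\<close> is the one at which the potential of the empty sum equals \<open>\<epsilon>\<close>.
\<close>

lemma barrier_iteration:
  assumes S: "S \<subseteq> carrier_vec m" and av: "averages_to m S G" and pG: "positive_form m G"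
    and eps: "\<epsilon> > 0" and m: "m \<ge> 1"
  shows "\<exists>vs B R. length vs = k \<and> set vs \<subseteq> S \<and> positive_form m B \<and> inverse_mats m B R \<and> pairing R G \<le> \<epsilon> \<and>
    (\<forall>c\<in>carrier_vec m. Re ((B *\<^sub>v c) \<bullet>c c) =
       (\<Sum>v\<leftarrow>vs. (cmod (c \<bullet>c v))\<^sup>2) - (real k / (1 + \<epsilon>) - real m / \<epsilon>) * Re ((G *\<^sub>v c) \<bullet>c c))"
proof (induction k)
  case 0
  note G = hermitian_formD(1)[of m G]
  have G: "G \<in> carrier_mat m m" using pG by (simp add: positive_form_def hermitian_form_def)
  obtain R where R: "inverse_mats m G R" using exists_inverse[OF G positive_form_det[OF pG]] by blast
  define a where "a = real m / \<epsilon>"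
  have a: "a > 0" using m eps by (simp add: a_def)
  let ?B = "complex_of_real a \<cdot>\<^sub>m G" and ?R = "complex_of_real (1 / a) \<cdot>\<^sub>m R"
  have "inverse_mats m ?B ?R" using inverse_mats_smult[OF R, of "complex_of_real a"] a by simp
  moreover have "positive_form m ?B" by (rule positive_form_smult[OF pG a])
  moreover have "pairing ?R G = \<epsilon>"
    unfolding pairing_smult[OF inverse_matsD(2)[OF R]] using pairing_inverse[OF R] m eps by (simp add: a_def)
  moreover have "\<forall>c\<in>carrier_vec m. Re ((?B *\<^sub>v c) \<bullet>c c) = a * Re ((G *\<^sub>v c) \<bullet>c c)"
    using G by (auto simp: smult_mat_mult_vec[of _ m] cscalar_smult_left[of _ m] square_mat_closed)
  ultimately show ?case
    by (intro exI[of _ "[]"] exI[of _ ?B] exI[of _ ?R]) (simp add: a_def)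
next
  case (Suc k)
  then obtain vs B R where IH: "length vs = k" "set vs \<subseteq> S" "positive_form m B" "inverse_mats m B R" "pairing R G \<le> \<epsilon>"
    "\<And>c. c \<in> carrier_vec m \<Longrightarrow> Re ((B *\<^sub>v c) \<bullet>c c) =
       (\<Sum>v\<leftarrow>vs. (cmod (c \<bullet>c v))\<^sup>2) - (real k / (1 + \<epsilon>) - real m / \<epsilon>) * Re ((G *\<^sub>v c) \<bullet>c c)"
    by blast
  have G: "G \<in> carrier_mat m m" using pG by (simp add: positive_form_def hermitian_form_def)
  have B: "B \<in> carrier_mat m m" using IH(4) by (simp add: inverse_mats_def)
  define \<delta> where "\<delta> = 1 / (1 + \<epsilon>)"
  obtain v R' where v: "v \<in> S" and
    *: "positive_form m (B - complex_of_real \<delta> \<cdot>\<^sub>m G + outer m v v)"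
    "inverse_mats m (B - complex_of_real \<delta> \<cdot>\<^sub>m G + outer m v v) R'" "pairing R' G \<le> \<epsilon>"
    using barrier_step[OF S av pG IH(3-5) eps \<delta>_def] by blast
  have "Re (((B - complex_of_real \<delta> \<cdot>\<^sub>m G + outer m v v) *\<^sub>v c) \<bullet>c c) =
       (\<Sum>v\<leftarrow>v # vs. (cmod (c \<bullet>c v))\<^sup>2) - (real (Suc k) / (1 + \<epsilon>) - real m / \<epsilon>) * Re ((G *\<^sub>v c) \<bullet>c c)"
    if c: "c \<in> carrier_vec m" for c :: "complex vec"
  proof -
    have vc: "v \<in> carrier_vec m" using v S by auto
    have "Re (((B - complex_of_real \<delta> \<cdot>\<^sub>m G + outer m v v) *\<^sub>v c) \<bullet>c c) =
      Re ((B *\<^sub>v c) \<bullet>c c) - \<delta> * Re ((G *\<^sub>v c) \<bullet>c c) + (cmod (c \<bullet>c v))\<^sup>2"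
      using c vc G B cscalar_outer[OF vc c]
      by (simp add: add_mult_distrib_mat_vec[of _ m m] minus_mult_distrib_mat_vec[of _ m m] smult_mat_mult_vec[of _ m]
          cscalar_minus_left[of _ m] cscalar_add_left[of _ m] cscalar_smult_left[of _ m] square_mat_closed del: of_real_power)
    also have "\<dots> = (\<Sum>v\<leftarrow>v # vs. (cmod (c \<bullet>c v))\<^sup>2) - (real (Suc k) / (1 + \<epsilon>) - real m / \<epsilon>) * Re ((G *\<^sub>v c) \<bullet>c c)"
      by (simp add: IH(6)[OF c] \<delta>_def add_divide_distrib ring_distribs)
    finally show ?thesis .
  qed
  thus ?case using * v IH(1,2)
    by (intro exI[of _ "v # vs"] exI[of _ "B - complex_of_real \<delta> \<cdot>\<^sub>m G + outer m v v"] exI[of _ R']) simp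
qed

text \<open>
  The value \<open>\<epsilon> = \<surd>m / (\<surd>n - \<surd>m)\<close> maximises the final level \<open>n / (1 + \<epsilon>) - m / \<epsilon>\<close>, and the maximum is
  \<open>(\<surd>n - \<surd>m)\<^sup>2\<close>. The second summand of the constant is \<open>1 / \<epsilon>\<close>, the distance to the barrier that the bounded
  potential guarantees.
\<close>

lemma unweighted_selection:
  assumes S: "S \<subseteq> carrier_vec m" and av: "averages_to m S G" and pG: "positive_form m G"
    and m: "m \<ge> 1" and n: "m < n"
  shows "\<exists>vs. length vs = n \<and> set vs \<subseteq> S \<and> (\<forall>c\<in>carrier_vec m.
    ((sqrt n - sqrt m)\<^sup>2 + (sqrt n - sqrt m) / sqrt m) * Re ((G *\<^sub>v c) \<bullet>c c) \<le> (\<Sum>v\<leftarrow>vs. (cmod (c \<bullet>c v))\<^sup>2))"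
proof -
  define r s where "r = sqrt (real m)" and "s = sqrt (real n)"
  have r: "0 < r" "r < s" "r\<^sup>2 = real m" "s\<^sup>2 = real n" using m n by (auto simp: r_def s_def)
  define \<epsilon> where "\<epsilon> = r / (s - r)"
  have eps: "\<epsilon> > 0" using r by (simp add: \<epsilon>_def)
  have e1: "1 + \<epsilon> = s / (s - r)" using r by (simp add: \<epsilon>_def field_simps)
  have level: "real n / (1 + \<epsilon>) - real m / \<epsilon> = (s - r)\<^sup>2"
  proof -
    have "s\<^sup>2 / (1 + \<epsilon>) = s * (s - r)" using r unfolding e1 by (simp add: field_simps power2_eq_square)
    moreover have "r\<^sup>2 / \<epsilon> = r * (s - r)" using r by (simp add: \<epsilon>_def field_simps power2_eq_square)
    ultimately show ?thesis using r by (simp add: power2_eq_square algebra_simps)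
  qed
  have G: "G \<in> carrier_mat m m" using pG by (simp add: positive_form_def hermitian_form_def)
  obtain vs B R where it: "length vs = n" "set vs \<subseteq> S" "positive_form m B" "inverse_mats m B R" "pairing R G \<le> \<epsilon>"
    "\<And>c. c \<in> carrier_vec m \<Longrightarrow> Re ((B *\<^sub>v c) \<bullet>c c) =
       (\<Sum>v\<leftarrow>vs. (cmod (c \<bullet>c v))\<^sup>2) - (real n / (1 + \<epsilon>) - real m / \<epsilon>) * Re ((G *\<^sub>v c) \<bullet>c c)"
    using barrier_iteration[OF S av pG eps m, of n] by blast
  have "((s - r)\<^sup>2 + (s - r) / r) * Re ((G *\<^sub>v c) \<bullet>c c) \<le> (\<Sum>v\<leftarrow>vs. (cmod (c \<bullet>c v))\<^sup>2)"
    if c: "c \<in> carrier_vec m" for c :: "complex vec"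
  proof -
    define b g where "b = Re ((B *\<^sub>v c) \<bullet>c c)" and "g = Re ((G *\<^sub>v c) \<bullet>c c)"
    have "g \<le> pairing R G * b" unfolding b_def g_def by (rule form_le_potential[OF S av G it(3,4) c])
    also have "\<dots> \<le> \<epsilon> * b" using it(5) positive_form_nonneg[OF it(3) c] by (simp add: b_def mult_right_mono)
    finally have "g / \<epsilon> \<le> b" using eps by (simp add: field_simps)
    moreover have "g / \<epsilon> = (s - r) / r * g" by (simp add: \<epsilon>_def)
    moreover have "b = (\<Sum>v\<leftarrow>vs. (cmod (c \<bullet>c v))\<^sup>2) - (s - r)\<^sup>2 * g"
      using it(6)[OF c] unfolding level b_def g_def .
    ultimately show ?thesis unfolding g_def[symmetric] by (simp add: ring_distribs)
  qed
  thus ?thesis using it(1,2) unfolding r_def s_def by blast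
qed

section \<open>Averages with nearly maximal determinant\<close>

text \<open>
  The two ways of eliminating one off-diagonal block of the matrix with rows \<open>(1, u)\<close> and \<open>(-w\<^sup>*, 1)\<close> give both
  sides of the identity.
\<close>

lemma det_one_plus_outer:
  assumes u: "u \<in> carrier_vec m" and w: "w \<in> carrier_vec m"
  shows "det (1\<^sub>m m + outer m u w) = 1 + u \<bullet>c w"
proof -
  define U where "U = mat m 1 (\<lambda>(i, j). u $ i)"
  define W where "W = mat 1 m (\<lambda>(i, j). cnj (w $ j))"
  have U: "U \<in> carrier_mat m 1" and W: "W \<in> carrier_mat 1 m" by (simp_all add: U_def W_def)
  have UW: "U * W = outer m u w"
    by (rule eq_matI) (auto simp: U_def W_def outer_def scalar_prod_def)
  have WU: "(1\<^sub>m 1 + W * U) $$ (0, 0) = 1 + u \<bullet>c w"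
    using w by (auto simp: U_def W_def scalar_prod_def cscalar_sum[of _ m] atLeast0LessThan mult.commute intro!: sum.cong)
  let ?N = "four_block_mat (1\<^sub>m m) U (- W) (1\<^sub>m 1)"
  have N: "?N \<in> carrier_mat (m + 1) (m + 1)" by (rule four_block_carrier_mat) auto
  have mW: "- W \<in> carrier_mat 1 m" using W by simp
  have UmW: "U * (- W) = - outer m u w"
    unfolding UW[symmetric] using U W by (intro eq_matI) (auto simp: scalar_prod_def sum_negf)
  have "four_block_mat (1\<^sub>m m + outer m u w) U (0\<^sub>m 1 m) (1\<^sub>m 1) * four_block_mat (1\<^sub>m m) (0\<^sub>m m 1) (- W) (1\<^sub>m 1) = ?N"
  proof -
    have O: "1\<^sub>m m + outer m u w \<in> carrier_mat m m" by simp
    have "(1\<^sub>m m + outer m u w) * 1\<^sub>m m + U * (- W) = 1\<^sub>m m"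
      unfolding UmW right_mult_one_mat[OF O] by (rule eq_matI) (auto simp: outer_def)
    moreover have "(1\<^sub>m m + outer m u w) * 0\<^sub>m m 1 + U * 1\<^sub>m 1 = U"
      unfolding right_mult_zero_mat[OF O] using U by simp
    moreover have "0\<^sub>m 1 m * 1\<^sub>m m + 1\<^sub>m 1 * (- W) = - W" using mW by simp
    moreover have "0\<^sub>m 1 m * 0\<^sub>m m 1 + 1\<^sub>m 1 * 1\<^sub>m 1 = (1\<^sub>m 1 :: complex mat)" by simp
    ultimately show ?thesis
      by (subst mult_four_block_mat[OF O U zero_carrier_mat one_carrier_mat one_carrier_mat zero_carrier_mat mW one_carrier_mat])
         (simp only:)
  qed
  moreover have "four_block_mat (1\<^sub>m m + outer m u w) U (0\<^sub>m 1 m) (1\<^sub>m 1) \<in> carrier_mat (m + 1) (m + 1)"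
    "four_block_mat (1\<^sub>m m) (0\<^sub>m m 1) (- W) (1\<^sub>m 1) \<in> carrier_mat (m + 1) (m + 1)"
    by (rule four_block_carrier_mat; simp)+
  ultimately have "det ?N = det (four_block_mat (1\<^sub>m m + outer m u w) U (0\<^sub>m 1 m) (1\<^sub>m 1))
      * det (four_block_mat (1\<^sub>m m) (0\<^sub>m m 1) (- W) (1\<^sub>m 1))"
    by (metis det_mult)
  also have "\<dots> = det (1\<^sub>m m + outer m u w)"
    using det_four_block_mat_lower_left_zero[of "1\<^sub>m m + outer m u w" m U 1 "0\<^sub>m 1 m" "1\<^sub>m 1"]
      det_four_block_mat_upper_right_zero[of "1\<^sub>m m" m "0\<^sub>m m 1" 1 "- W" "1\<^sub>m 1"] U mW by (simp add: square_mat_closed)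
  finally have 1: "det ?N = det (1\<^sub>m m + outer m u w)" .
  have "four_block_mat (1\<^sub>m m) (0\<^sub>m m 1) W (1\<^sub>m 1) * ?N = four_block_mat (1\<^sub>m m) U (0\<^sub>m 1 m) (1\<^sub>m 1 + W * U)"
  proof -
    have "1\<^sub>m m * 1\<^sub>m m + 0\<^sub>m m 1 * (- W) = (1\<^sub>m m :: complex mat)"
      using left_mult_zero_mat[OF mW, of m] by simp
    moreover have "1\<^sub>m m * U + 0\<^sub>m m 1 * 1\<^sub>m 1 = U"
      using U by simp
    moreover have "W * 1\<^sub>m m + 1\<^sub>m 1 * (- W) = 0\<^sub>m 1 m"
      unfolding right_mult_one_mat[OF W] left_mult_one_mat[OF mW] using W by (intro eq_matI) auto
    moreover have "W * U + 1\<^sub>m 1 * 1\<^sub>m 1 = 1\<^sub>m 1 + W * U"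
      using W U by (intro eq_matI) auto
    ultimately show ?thesis
      by (subst mult_four_block_mat[OF one_carrier_mat zero_carrier_mat W one_carrier_mat one_carrier_mat U mW one_carrier_mat])
         (simp only:)
  qed
  moreover have "four_block_mat (1\<^sub>m m) (0\<^sub>m m 1) W (1\<^sub>m 1) \<in> carrier_mat (m + 1) (m + 1)"
    by (rule four_block_carrier_mat; simp)+
  ultimately have "det (four_block_mat (1\<^sub>m m) (0\<^sub>m m 1) W (1\<^sub>m 1)) * det ?N
      = det (four_block_mat (1\<^sub>m m) U (0\<^sub>m 1 m) (1\<^sub>m 1 + W * U))"
    using N by (metis det_mult)
  moreover have "det (four_block_mat (1\<^sub>m m) (0\<^sub>m m 1) W (1\<^sub>m 1)) = 1"
    using det_four_block_mat_upper_right_zero[of "1\<^sub>m m" m "0\<^sub>m m 1" 1 W "1\<^sub>m 1"] W by simp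
  moreover have "det (four_block_mat (1\<^sub>m m) U (0\<^sub>m 1 m) (1\<^sub>m 1 + W * U)) = 1 + u \<bullet>c w"
    using det_four_block_mat_lower_left_zero[of "1\<^sub>m m" m U 1 "0\<^sub>m 1 m" "1\<^sub>m 1 + W * U"] U W WU
      det_single[of "1\<^sub>m 1 + W * U"] by simp
  ultimately show ?thesis using 1 by simp
qed

lemma det_mix_outer:
  assumes inv: "inverse_mats m G R" and v: "v \<in> carrier_vec m" and a: "a \<noteq> 0" and m: "m \<ge> 1"
  shows "det (a \<cdot>\<^sub>m G + b \<cdot>\<^sub>m outer m v v) = det G * (a ^ (m - 1) * (a + b * ((R *\<^sub>v v) \<bullet>c v)))"
proof -
  note R = inverse_matsD[OF inv]
  define u where "u = (b / a) \<cdot>\<^sub>v (R *\<^sub>v v)"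
  have Rv: "R *\<^sub>v v \<in> carrier_vec m" using R(2) v by auto
  have u: "u \<in> carrier_vec m" using Rv by (simp add: u_def)
  have Gu: "G *\<^sub>v u = (b / a) \<cdot>\<^sub>v v" using R Rv v by (simp add: u_def mult_mat_vec[of _ m m])
  have "a \<cdot>\<^sub>m G + b \<cdot>\<^sub>m outer m v v = G * (a \<cdot>\<^sub>m (1\<^sub>m m + outer m u v))"
  proof (rule mat_eqI_vec)
    fix x :: "complex vec" assume x: "x \<in> carrier_vec m"
    have ux: "(x \<bullet>c v) \<cdot>\<^sub>v u \<in> carrier_vec m" using u by simp
    have "(G * (a \<cdot>\<^sub>m (1\<^sub>m m + outer m u v))) *\<^sub>v x = a \<cdot>\<^sub>v (G *\<^sub>v (x + (x \<bullet>c v) \<cdot>\<^sub>v u))"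
      using R(1) x u v by (simp add: assoc_mult_mat_vec[of _ m m _ m] square_mat_closed smult_mat_mult_vec[of _ m]
          add_mult_distrib_mat_vec[of _ m m] outer_mult_vec mult_mat_vec[of _ m m])
    also have "G *\<^sub>v (x + (x \<bullet>c v) \<cdot>\<^sub>v u) = G *\<^sub>v x + (x \<bullet>c v) \<cdot>\<^sub>v ((b / a) \<cdot>\<^sub>v v)"
      using R(1) x u by (simp add: mult_add_distrib_mat_vec[of _ m m] mult_mat_vec[of _ m m] Gu)
    also have "a \<cdot>\<^sub>v (G *\<^sub>v x + (x \<bullet>c v) \<cdot>\<^sub>v ((b / a) \<cdot>\<^sub>v v)) = a \<cdot>\<^sub>v (G *\<^sub>v x) + b \<cdot>\<^sub>v ((x \<bullet>c v) \<cdot>\<^sub>v v)"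
    proof -
      define y where "y = G *\<^sub>v x"
      have "y \<in> carrier_vec m" using R(1) x by (auto simp: y_def)
      thus ?thesis using a v unfolding y_def[symmetric] by (intro eq_vecI) (auto simp: field_simps)
    qed
    also have "\<dots> = (a \<cdot>\<^sub>m G + b \<cdot>\<^sub>m outer m v v) *\<^sub>v x"
      using R(1) x v by (simp add: add_mult_distrib_mat_vec[of _ m m] square_mat_closed smult_mat_mult_vec[of _ m] outer_mult_vec)
    finally show "(a \<cdot>\<^sub>m G + b \<cdot>\<^sub>m outer m v v) *\<^sub>v x = (G * (a \<cdot>\<^sub>m (1\<^sub>m m + outer m u v))) *\<^sub>v x" by simp
  qed (use R(1) in \<open>auto simp: square_mat_closed\<close>)
  hence "det (a \<cdot>\<^sub>m G + b \<cdot>\<^sub>m outer m v v) = det G * det (a \<cdot>\<^sub>m (1\<^sub>m m + outer m u v))"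
    using det_mult[OF R(1), of "a \<cdot>\<^sub>m (1\<^sub>m m + outer m u v)"] by (simp add: square_mat_closed)
  also have "det (a \<cdot>\<^sub>m (1\<^sub>m m + outer m u v)) = a ^ m * (1 + (b / a) * ((R *\<^sub>v v) \<bullet>c v))"
    using det_one_plus_outer[OF u v] u v Rv by (simp add: u_def cscalar_smult_left[of _ m] outer_def)
  also have "a ^ m = a ^ (m - 1) * a" using m by (cases m) auto
  also have "a ^ (m - 1) * a * (1 + (b / a) * ((R *\<^sub>v v) \<bullet>c v)) = a ^ (m - 1) * (a + b * ((R *\<^sub>v v) \<bullet>c v))"
    using a by (simp add: field_simps)
  finally show ?thesis .
qed

lemma det_bound:
  assumes "A \<in> carrier_mat m m" "\<And>i j. i < m \<Longrightarrow> j < m \<Longrightarrow> cmod (A $$ (i, j)) \<le> K"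
  shows "cmod (det A) \<le> fact m * K ^ m"
proof -
  have "cmod (det A) \<le> (\<Sum>p\<in>{p. p permutes {0..<m}}. cmod (signof p * (\<Prod>i = 0..<m. A $$ (i, p i))))"
    unfolding det_def'[OF assms(1)] by (rule norm_sum)
  also have "\<dots> \<le> (\<Sum>p\<in>{p. p permutes {0..<m}}. K ^ m)"
  proof (rule sum_mono)
    fix p assume "p \<in> {p. p permutes {0..<m}}"
    hence p: "p permutes {0..<m}" by simp
    have "cmod (signof p * (\<Prod>i = 0..<m. A $$ (i, p i))) = (\<Prod>i = 0..<m. cmod (A $$ (i, p i)))"
      by (simp add: norm_mult prod_norm sign_def)
    also have "\<dots> \<le> (\<Prod>i = 0..<m. K)"
      using permutes_in_image[OF p] assms(2) by (intro prod_mono) auto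
    finally show "cmod (signof p * (\<Prod>i = 0..<m. A $$ (i, p i))) \<le> K ^ m" by simp
  qed
  also have "\<dots> = fact m * K ^ m" by (simp add: card_permutations)
  finally show ?thesis .
qed

text \<open>
  If \<open>p = v\<^sup>* R v\<close> exceeded \<open>m + \<eta>\<close>, then mixing \<open>G\<close> with \<open>v v\<^sup>*\<close> in the proportion \<open>1 - t : t\<close> would multiply the
  determinant by \<open>(1 - t)\<^sup>m\<^sup>-\<^sup>1 (1 - t + t p)\<close>, which has derivative \<open>p - m \<ge> \<eta>\<close> at \<open>t = 0\<close> and is therefore above a
  constant \<open>\<phi> > 1\<close> for a suitable \<open>t\<close>. So it is enough that the determinant of \<open>G\<close> has modulus larger than the supremum
  divided by \<open>\<phi>\<close>.
\<close>

lemma near_optimal_design: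
  assumes S: "S \<subseteq> carrier_vec m" and K: "\<And>v i. v \<in> S \<Longrightarrow> i < m \<Longrightarrow> cmod (v $ i) \<le> K"
    and G0: "hermitian_form m G0" "averages_to m S G0" "det G0 \<noteq> 0" and m: "m \<ge> 1" and eta: "\<eta> > 0"
  shows "\<exists>G R. positive_form m G \<and> averages_to m S G \<and> inverse_mats m G R \<and>
    (\<forall>v\<in>S. Re ((R *\<^sub>v v) \<bullet>c v) \<le> real m + \<eta>)"
proof -
  define \<D> where "\<D> = {G. hermitian_form m G \<and> averages_to m S G}"
  define s where "s = (SUP G\<in>\<D>. cmod (det G))"
  have bdd: "bdd_above ((\<lambda>G. cmod (det G)) ` \<D>)"
    using det_bound[OF hermitian_formD(1) averages_to_entry_bound[OF _ S K]]
    by (intro bdd_aboveI2[of _ _ "fact m * (K\<^sup>2) ^ m"]) (auto simp: \<D>_def)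
  have G0D: "G0 \<in> \<D>" using G0 by (simp add: \<D>_def)
  have "cmod (det G0) \<le> s" unfolding s_def by (rule cSUP_upper[OF G0D bdd])
  hence s0: "s > 0" using G0(3) by (smt (verit) zero_less_norm_iff)
  \<comment> \<open>Bernoulli bounds the factor from below by \<open>(1 - a t) (1 - t + t (m + \<eta>)) = 1 + t (\<eta> - t a (a + \<eta>))\<close>; this
     \<open>t\<close> makes the bracket positive and keeps \<open>t < 1\<close> and \<open>a t < 1\<close>.\<close>
  define a t where "a = real m - 1" and "t = \<eta> / ((a + 1) * (a + \<eta> + 1))"
  have a0: "a \<ge> 0" using m by (simp add: a_def)
  have den: "(a + 1) * (a + \<eta> + 1) > \<eta>" "(a + 1) * (a + \<eta> + 1) > a * (a + \<eta>)" "(a + 1) * (a + \<eta> + 1) > a * \<eta>" "(a + 1) * (a + \<eta> + 1) > 0"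
    using a0 eta by (auto simp: algebra_simps add_pos_nonneg intro!: add_nonneg_pos add_nonneg_nonneg)
  have t: "0 < t" "t < 1" using den eta by (auto simp: t_def)
  define \<phi> where "\<phi> = (1 - t) ^ (m - 1) * (1 - t + t * (real m + \<eta>))"
  have phi: "\<phi> > 1"
  proof -
    have ta: "t * a < 1"  unfolding t_def using den by (simp add: mult.commute)
    have "t * (a * (a + \<eta>)) < \<eta>"
      unfolding t_def using den eta by (simp add: pos_divide_less_eq)
    hence "0 < t * (\<eta> - t * (a * (a + \<eta>)))" using t by simp
    hence "1 < (1 - a * t) * (1 - t + t * (real m + \<eta>))" by (simp add: a_def algebra_simps)
    also have "\<dots> \<le> \<phi>"
    proof -
      have "1 + real (m - 1) * (- t) \<le> (1 + (- t)) ^ (m - 1)" using t by (intro Bernoulli_inequality) auto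
      moreover have "real (m - 1) = a" using m by (simp add: a_def)
      ultimately have "1 - a * t \<le> (1 - t) ^ (m - 1)" by simp
      moreover have "0 \<le> 1 - t + t * (real m + \<eta>)" using t eta by (simp add: add_nonneg_nonneg)
      ultimately show ?thesis unfolding \<phi>_def by (rule mult_right_mono)
    qed
    finally show ?thesis .
  qed
  have "s / \<phi> < s" using s0 phi by (simp add: pos_divide_less_eq)
  then obtain G where GD: "G \<in> \<D>" and G: "s / \<phi> < cmod (det G)"
    unfolding s_def using less_cSUP_iff[OF _ bdd] G0D by blast
  have d0: "det G \<noteq> 0" using G s0 phi by (smt (verit) divide_pos_pos norm_zero)
  have hG: "hermitian_form m G" and av: "averages_to m S G" using GD by (auto simp: \<D>_def)
  have pG: "positive_form m G" by (rule averages_to_positive(2)[OF hG av S d0])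
  obtain R where R: "inverse_mats m G R" using exists_inverse[OF hermitian_formD(1)[OF hG] d0] by blast
  have "Re ((R *\<^sub>v v) \<bullet>c v) \<le> real m + \<eta>" if v: "v \<in> S" for v
  proof (rule ccontr)
    assume np: "\<not> ?thesis"
    define p where "p = Re ((R *\<^sub>v v) \<bullet>c v)"
    have p: "p > real m + \<eta>" using np by (simp add: p_def)
    have vc: "v \<in> carrier_vec m" using v S by auto
    have pc: "(R *\<^sub>v v) \<bullet>c v = complex_of_real p"
      unfolding p_def by (rule hermitian_form_real[OF hermitian_inverse[OF R hG] vc])
    let ?G = "complex_of_real (1 - t) \<cdot>\<^sub>m G + complex_of_real t \<cdot>\<^sub>m outer m v v"
    have "?G \<in> \<D>"
      unfolding \<D>_def using t
      by (auto intro!: hermitian_add hermitian_smult hG hermitian_outer vc averages_to_mix av hermitian_formD(1)[OF hG]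
          averages_to_outer v simp del: of_real_diff)
    hence "cmod (det ?G) \<le> s" unfolding s_def by (rule cSUP_upper[OF _ bdd])
    moreover have "det ?G = det G * complex_of_real ((1 - t) ^ (m - 1) * (1 - t + t * p))"
      using det_mix_outer[OF R vc, of "complex_of_real (1 - t)" "complex_of_real t"] t m pc by simp
    hence "cmod (det ?G) = cmod (det G) * ((1 - t) ^ (m - 1) * (1 - t + t * p))"
      using t p eta by (simp only: norm_mult norm_of_real) (simp add: add_nonneg_nonneg)
    moreover have "\<phi> \<le> (1 - t) ^ (m - 1) * (1 - t + t * p)"
      unfolding \<phi>_def using t p by (intro mult_left_mono add_left_mono) auto
    ultimately have "cmod (det G) * \<phi> \<le> s"
      by (smt (verit) mult_left_mono norm_ge_zero)
    moreover have "s < cmod (det G) * \<phi>" using G phi by (simp add: pos_divide_less_eq)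
    ultimately show False by simp
  qed
  thus ?thesis using pG av R by blast
qed

section \<open>Averages with respect to a probability measure\<close>

definition gram :: "nat \<Rightarrow> 'b measure \<Rightarrow> ('b \<Rightarrow> complex vec) \<Rightarrow> complex mat" where
  "gram m N \<phi> = mat m m (\<lambda>(i, j). \<integral>x. \<phi> x $ i * cnj (\<phi> x $ j) \<partial>N)"

context
  fixes N :: "'b measure" and \<phi> :: "'b \<Rightarrow> complex vec" and m :: nat and K :: real
  assumes N: "prob_space N"
    and meas: "\<And>i. i < m \<Longrightarrow> (\<lambda>x. \<phi> x $ i) \<in> borel_measurable N"
    and bound: "\<And>x i. x \<in> space N \<Longrightarrow> i < m \<Longrightarrow> cmod (\<phi> x $ i) \<le> K"
    and vec: "\<And>x. x \<in> space N \<Longrightarrow> \<phi> x \<in> carrier_vec m"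
begin


lemma gram_integrable:
  assumes "i < m" "j < m"
  shows "integrable N (\<lambda>x. \<phi> x $ i * cnj (\<phi> x $ j))"
proof -
  interpret prob_space N by (rule N)
  have [measurable]: "(\<lambda>x. \<phi> x $ i) \<in> borel_measurable N" "(\<lambda>x. \<phi> x $ j) \<in> borel_measurable N"
    using meas assms by auto
  have cnj: "cnj \<in> borel_measurable borel"
    by (intro borel_measurable_continuous_onI continuous_intros)
  show ?thesis
  proof (rule integrable_const_bound[where B = "K * K"])
    show "AE x in N. norm (\<phi> x $ i * cnj (\<phi> x $ j)) \<le> K * K"
      using bound assms by (intro AE_I2) (auto simp: norm_mult intro!: mult_mono intro: order_trans[OF norm_ge_zero])
    show "(\<lambda>x. \<phi> x $ i * cnj (\<phi> x $ j)) \<in> borel_measurable N"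
      by (intro borel_measurable_times measurable_compose[OF _ cnj]; measurable)
  qed
qed

lemma gram_hermitian: "hermitian_form m (gram m N \<phi>)"
proof (rule hermitian_formI)
  fix i j assume ij: "i < m" "j < m"
  have "cnj (\<integral>x. \<phi> x $ i * cnj (\<phi> x $ j) \<partial>N) = (\<integral>x. cnj (\<phi> x $ i * cnj (\<phi> x $ j)) \<partial>N)"
    by (rule Bochner_Integration.integral_cnj[symmetric])
  also have "\<dots> = (\<integral>x. \<phi> x $ j * cnj (\<phi> x $ i) \<partial>N)"
    by (intro Bochner_Integration.integral_cong) auto
  finally show "gram m N \<phi> $$ (j, i) = cnj (gram m N \<phi> $$ (i, j))"
    using ij by (simp add: gram_def)
qed (simp add: gram_def)

lemma pairing_gram:
  assumes H: "H \<in> carrier_mat m m"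
  shows "integrable N (\<lambda>x. Re ((H *\<^sub>v \<phi> x) \<bullet>c \<phi> x))"
    and "pairing H (gram m N \<phi>) = (\<integral>x. Re ((H *\<^sub>v \<phi> x) \<bullet>c \<phi> x) \<partial>N)"
proof -
  let ?F = "\<lambda>x. \<Sum>i<m. \<Sum>j<m. H $$ (i, j) * (\<phi> x $ j * cnj (\<phi> x $ i))"
  have F: "(H *\<^sub>v \<phi> x) \<bullet>c \<phi> x = ?F x" if "x \<in> space N" for x
    using H vec[OF that]
    by (simp add: cscalar_sum[of _ m] mult_mat_vec_sum[of _ m] sum_distrib_right mult.assoc del: index_mult_mat_vec)
  have int: "integrable N ?F"
    by (intro Bochner_Integration.integrable_sum integrable_mult_right gram_integrable) auto
  have "integrable N (\<lambda>x. Re (?F x))" using int by (rule integrable_Re)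
  thus "integrable N (\<lambda>x. Re ((H *\<^sub>v \<phi> x) \<bullet>c \<phi> x))"
    using F by (subst Bochner_Integration.integrable_cong[OF refl]) auto
  have "(\<integral>x. ?F x \<partial>N) = (\<Sum>i<m. \<integral>x. (\<Sum>j<m. H $$ (i, j) * (\<phi> x $ j * cnj (\<phi> x $ i))) \<partial>N)"
    by (rule Bochner_Integration.integral_sum)
       (intro Bochner_Integration.integrable_sum integrable_mult_right gram_integrable; simp)
  also have "\<dots> = (\<Sum>i<m. \<Sum>j<m. \<integral>x. H $$ (i, j) * (\<phi> x $ j * cnj (\<phi> x $ i)) \<partial>N)"
    by (intro sum.cong refl Bochner_Integration.integral_sum integrable_mult_right gram_integrable) auto
  also have "\<dots> = (\<Sum>i<m. \<Sum>j<m. H $$ (i, j) * gram m N \<phi> $$ (j, i))"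
    by (intro sum.cong refl) (simp add: gram_def)
  finally have "(\<integral>x. ?F x \<partial>N) = (\<Sum>i<m. \<Sum>j<m. H $$ (i, j) * gram m N \<phi> $$ (j, i))" .
  hence "pairing H (gram m N \<phi>) = Re (\<integral>x. ?F x \<partial>N)"
    using H by (simp add: pairing_def)
  also have "\<dots> = (\<integral>x. Re (?F x) \<partial>N)" using int by (rule integral_Re[symmetric])
  also have "\<dots> = (\<integral>x. Re ((H *\<^sub>v \<phi> x) \<bullet>c \<phi> x) \<partial>N)"
    using F by (intro Bochner_Integration.integral_cong) auto
  finally show "pairing H (gram m N \<phi>) = (\<integral>x. Re ((H *\<^sub>v \<phi> x) \<bullet>c \<phi> x) \<partial>N)" .
qed

text \<open>
  A function cannot lie below its expectation everywhere.
\<close>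

lemma averages_to_gram:
  assumes S: "\<And>x. x \<in> space N \<Longrightarrow> \<phi> x \<in> S"
  shows "averages_to m S (gram m N \<phi>)"
  unfolding averages_to_def
proof (rule ballI, rule ccontr)
  interpret prob_space N by (rule N)
  fix H :: "complex mat" assume H: "H \<in> carrier_mat m m"
  assume "\<not> (\<exists>v\<in>S. pairing H (gram m N \<phi>) \<le> Re ((H *\<^sub>v v) \<bullet>c v))"
  hence "AE x in N. Re ((H *\<^sub>v \<phi> x) \<bullet>c \<phi> x) < pairing H (gram m N \<phi>)"
    using S by (intro AE_I2) force
  hence "expectation (\<lambda>x. Re ((H *\<^sub>v \<phi> x) \<bullet>c \<phi> x)) < pairing H (gram m N \<phi>)"
    by (rule expectation_less[OF pairing_gram(1)[OF H]])
  thus False using pairing_gram(2)[OF H] by simp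
qed

lemma gram_form:
  assumes c: "c \<in> carrier_vec m"
  shows "Re ((gram m N \<phi> *\<^sub>v c) \<bullet>c c) = (\<integral>x. (cmod (c \<bullet>c \<phi> x))\<^sup>2 \<partial>N)"
proof -
  have "Re ((gram m N \<phi> *\<^sub>v c) \<bullet>c c) = pairing (outer m c c) (gram m N \<phi>)"
    by (rule pairing_outer[symmetric]) (auto simp: gram_def c)
  also have "\<dots> = (\<integral>x. Re ((outer m c c *\<^sub>v \<phi> x) \<bullet>c \<phi> x) \<partial>N)"
    by (rule pairing_gram(2)) simp
  also have "\<dots> = (\<integral>x. (cmod (c \<bullet>c \<phi> x))\<^sup>2 \<partial>N)"
  proof (rule Bochner_Integration.integral_cong[OF refl])
    fix x assume "x \<in> space N"
    from vec[OF this] show "Re ((outer m c c *\<^sub>v \<phi> x) \<bullet>c \<phi> x) = (cmod (c \<bullet>c \<phi> x))\<^sup>2"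
      using cscalar_outer[OF c, of "\<phi> x"] cscalar_commute[OF c, of "\<phi> x"] by (simp only: Re_complex_of_real) simp
  qed
  finally show ?thesis .
qed

end


section \<open>Points with nearly maximal determinant\<close>

definition columns_mat :: "nat \<Rightarrow> (nat \<Rightarrow> complex vec) \<Rightarrow> complex mat" where
  "columns_mat k w = mat k k (\<lambda>(i, j). w j $ i)"

text \<open>
  Expanding the determinant along its last column shows that, as a function of the last vector \<open>v\<close>, it has the
  form \<open>\<langle>v, c\<rangle>\<close>. The last coordinate of \<open>c\<close> is the nonzero determinant of the previous stage, so
  \<open>c \<noteq> 0\<close> and the value is nonzero for some \<open>v \<in> S\<close>.
\<close>

lemma exists_nonsingular_columns:
  assumes S: "S \<subseteq> carrier_vec m"
    and total: "\<And>c. c \<in> carrier_vec m \<Longrightarrow> (\<And>v. v \<in> S \<Longrightarrow> c \<bullet>c v = 0) \<Longrightarrow> c = 0\<^sub>v m"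
  shows "k \<le> m \<Longrightarrow> \<exists>w. (\<forall>i<k. w i \<in> S) \<and> det (columns_mat k w) \<noteq> 0"
proof (induction k)
  case 0
  show ?case by (auto simp: columns_mat_def)
next
  case (Suc k)
  then obtain w where w: "\<forall>i<k. w i \<in> S" "det (columns_mat k w) \<noteq> 0" by auto
  define cof where "cof = (\<lambda>i. cofactor (columns_mat (Suc k) w) i k)"
  have expand: "det (columns_mat (Suc k) (w(k := v))) = (\<Sum>i<Suc k. v $ i * cof i)" for v
  proof -
    have del: "mat_delete (columns_mat (Suc k) (w(k := v))) i k = mat_delete (columns_mat (Suc k) w) i k" for i
      by (rule eq_matI) (auto simp: mat_delete_def columns_mat_def)
    show ?thesis
    proof -
      have "columns_mat (Suc k) (w(k := v)) \<in> carrier_mat (Suc k) (Suc k)" by (simp add: columns_mat_def)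
      hence "det (columns_mat (Suc k) (w(k := v)))
          = (\<Sum>i<Suc k. columns_mat (Suc k) (w(k := v)) $$ (i, k) * cofactor (columns_mat (Suc k) (w(k := v))) i k)"
        by (rule laplace_expansion_column) simp
      also have "\<dots> = (\<Sum>i<Suc k. v $ i * cof i)"
      proof (rule sum.cong[OF refl])
        fix i assume "i \<in> {..<Suc k}"
        hence "columns_mat (Suc k) (w(k := v)) $$ (i, k) = v $ i" by (simp add: columns_mat_def)
        thus "columns_mat (Suc k) (w(k := v)) $$ (i, k) * cofactor (columns_mat (Suc k) (w(k := v))) i k = v $ i * cof i"
          by (simp only: cofactor_def del cof_def)
      qed
      finally show ?thesis .
    qed
  qed
  have "mat_delete (columns_mat (Suc k) w) k k = columns_mat k w"
    by (rule eq_matI) (auto simp: mat_delete_def columns_mat_def)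
  hence ck: "cof k \<noteq> 0" using w(2) by (simp add: cof_def cofactor_def)
  define c where "c = vec m (\<lambda>i. if i \<le> k then cnj (cof i) else 0)"
  have c: "c \<in> carrier_vec m" by (simp add: c_def)
  have "c $ k \<noteq> 0" using ck Suc.prems by (simp add: c_def)
  hence "c \<noteq> 0\<^sub>v m" using Suc.prems by auto
  then obtain v where v: "v \<in> S" "c \<bullet>c v \<noteq> 0" using total[OF c] by blast
  have "c \<bullet>c v = (\<Sum>i<m. c $ i * cnj (v $ i))" using v S by (intro cscalar_sum) auto
  also have "\<dots> = (\<Sum>i<Suc k. cnj (cof i) * cnj (v $ i))"
    using Suc.prems by (intro sum.mono_neutral_cong_right) (auto simp: c_def)
  also have "\<dots> = cnj (det (columns_mat (Suc k) (w(k := v))))"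
    unfolding expand by (simp add: mult.commute del: sum.lessThan_Suc)
  finally have "det (columns_mat (Suc k) (w(k := v))) \<noteq> 0" using v(2) by auto
  moreover have "\<forall>i<Suc k. (w(k := v)) i \<in> S" using w(1) v(1) by auto
  ultimately show ?case by blast
qed

text \<open>
  Write \<open>v = \<Sum>\<^sub>i y\<^sub>i w\<^sub>i\<close>. By Cramer's rule, \<open>y\<^sub>k\<close> is the quotient of the determinants after and before \<open>w\<^sub>k\<close> is
  replaced by \<open>v\<close>, which is at most 2 in modulus if the latter is at least half of the supremum.
\<close>

lemma near_fekete_points:
  assumes S: "S \<subseteq> carrier_vec m" and K: "\<And>v i. v \<in> S \<Longrightarrow> i < m \<Longrightarrow> cmod (v $ i) \<le> K"
    and total: "\<And>c. c \<in> carrier_vec m \<Longrightarrow> (\<And>v. v \<in> S \<Longrightarrow> c \<bullet>c v = 0) \<Longrightarrow> c = 0\<^sub>v m"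
  shows "\<exists>w. (\<forall>i<m. w i \<in> S) \<and>
    (\<forall>c\<in>carrier_vec m. \<forall>v\<in>S. cmod (c \<bullet>c v) \<le> 2 * (\<Sum>i<m. cmod (c \<bullet>c w i)))"
proof -
  define W where "W = {w. \<forall>i<m. w i \<in> S}"
  define s where "s = (SUP w\<in>W. cmod (det (columns_mat m w)))"
  have bdd: "bdd_above ((\<lambda>w. cmod (det (columns_mat m w))) ` W)"
    using K by (intro bdd_aboveI2[of _ _ "fact m * K ^ m"] det_bound) (auto simp: W_def columns_mat_def)
  obtain w0 where w0: "w0 \<in> W" "det (columns_mat m w0) \<noteq> 0"
    using exists_nonsingular_columns[OF S total, of m] by (auto simp: W_def)
  have "cmod (det (columns_mat m w0)) \<le> s" unfolding s_def by (rule cSUP_upper[OF w0(1) bdd])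
  hence s0: "s > 0" using w0(2) by (smt (verit) zero_less_norm_iff)
  hence "s / 2 < s" by simp
  then obtain w where w: "w \<in> W" "s / 2 < cmod (det (columns_mat m w))"
    unfolding s_def using less_cSUP_iff[OF _ bdd] w0(1) by blast
  let ?C = "columns_mat m w"
  have C: "?C \<in> carrier_mat m m" by (simp add: columns_mat_def)
  have d0: "det ?C \<noteq> 0" using w(2) s0 by (smt (verit) divide_pos_pos norm_zero)
  have wc: "w i \<in> carrier_vec m" if "i < m" for i using w(1) S that by (auto simp: W_def)
  have "cmod (c \<bullet>c v) \<le> 2 * (\<Sum>i<m. cmod (c \<bullet>c w i))" if c: "c \<in> carrier_vec m" and v: "v \<in> S" for c v
  proof -
    have vc: "v \<in> carrier_vec m" using v S by auto
    obtain R where R: "inverse_mats m ?C R" using exists_inverse[OF C d0] by blast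
    define y where "y = R *\<^sub>v v"
    have y: "y \<in> carrier_vec m" "?C *\<^sub>v y = v" using inverse_matsD[OF R] vc by (auto simp: y_def square_mat_closed(5))
    have y2: "cmod (y $ k) \<le> 2" if k: "k < m" for k
    proof -
      have "replace_col ?C v k = columns_mat m (w(k := v))"
        using vc by (intro eq_matI) (auto simp: replace_col_def columns_mat_def)
      hence "det (columns_mat m (w(k := v))) = y $ k * det ?C"
        using cramer_lemma_mat[OF C y(1) k] y(2) by simp
      moreover have "w(k := v) \<in> W" using w(1) v by (auto simp: W_def)
      hence "cmod (det (columns_mat m (w(k := v)))) \<le> s" unfolding s_def by (rule cSUP_upper[OF _ bdd])
      ultimately have "cmod (y $ k) * cmod (det ?C) \<le> s" by (simp add: norm_mult)
      also have "s \<le> 2 * cmod (det ?C)" using w(2) by simp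
      finally show ?thesis using d0 by simp
    qed
    have "c \<bullet>c v = (\<Sum>k<m. \<Sum>i<m. c $ k * cnj (w i $ k * y $ i))"
    proof -
      have "v $ k = (\<Sum>i<m. w i $ k * y $ i)" if "k < m" for k
        using mult_mat_vec_sum[OF C y(1) that] that unfolding y(2) by (simp add: columns_mat_def)
      thus ?thesis using vc by (simp add: cscalar_sum[of _ m] sum_distrib_left)
    qed
    also have "\<dots> = (\<Sum>i<m. \<Sum>k<m. c $ k * cnj (w i $ k * y $ i))" by (rule sum.swap)
    also have "\<dots> = (\<Sum>i<m. cnj (y $ i) * (c \<bullet>c w i))"
      using wc by (intro sum.cong refl) (simp add: cscalar_sum[of _ m] sum_distrib_left ac_simps)
    finally have "cmod (c \<bullet>c v) = cmod (\<Sum>i<m. cnj (y $ i) * (c \<bullet>c w i))" by simp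
    also have "\<dots> \<le> (\<Sum>i<m. 2 * cmod (c \<bullet>c w i))"
      using y2 by (intro sum_norm_le) (auto simp: norm_mult intro!: mult_right_mono)
    finally show ?thesis by (simp add: sum_distrib_left)
  qed
  thus ?thesis using w(1) unfolding W_def by blast
qed

text \<open>
  The uniform average over the points just found is definite: a vector orthogonal to all of them
  is orthogonal to \<open>S\<close>, by the bound just proved.
\<close>

lemma exists_definite_design:
  assumes S: "S \<subseteq> carrier_vec m" and K: "\<And>v i. v \<in> S \<Longrightarrow> i < m \<Longrightarrow> cmod (v $ i) \<le> K" and m: "m \<ge> 1"
    and total: "\<And>c. c \<in> carrier_vec m \<Longrightarrow> (\<And>v. v \<in> S \<Longrightarrow> c \<bullet>c v = 0) \<Longrightarrow> c = 0\<^sub>v m"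
  shows "\<exists>G. hermitian_form m G \<and> averages_to m S G \<and> det G \<noteq> 0"
proof -
  obtain w where w: "\<forall>i<m. w i \<in> S" "\<forall>c\<in>carrier_vec m. \<forall>v\<in>S. cmod (c \<bullet>c v) \<le> 2 * (\<Sum>i<m. cmod (c \<bullet>c w i))"
    using near_fekete_points[OF S K total] by blast
  \<comment> \<open>The uniform distribution is a measure on all natural numbers, so \<open>w\<close> is changed outside \<open>{..<m}\<close> to stay
     in \<open>S\<close> everywhere.\<close>
  define u where "u i = w (if i < m then i else 0)" for i
  have u: "u i \<in> S" for i using w(1) m by (auto simp: u_def)
  let ?N = "measure_pmf (pmf_of_set {..<m})"
  have ne: "{..<m} \<noteq> {}" using m by (auto simp: lessThan_empty_iff)
  note g = measure_pmf.prob_space_axioms[of "pmf_of_set {..<m}"]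
  have b: "cmod (u x $ i) \<le> K" if "i < m" for x i using K u that by blast
  have c: "u x \<in> carrier_vec m" for x using u S by blast
  let ?G = "gram m ?N u"
  have form: "Re ((?G *\<^sub>v c) \<bullet>c c) = (\<Sum>i<m. (cmod (c \<bullet>c u i))\<^sup>2) / real m" if "c \<in> carrier_vec m" for c
    using gram_form[OF g _ b c that] ne by (simp add: integral_pmf_of_set)
  have h: "hermitian_form m ?G" by (rule gram_hermitian[OF g _ b c]) auto
  have av: "averages_to m S ?G" by (rule averages_to_gram[OF g _ b c u]) auto
  have "positive_form m ?G"
    unfolding positive_form_def
  proof (intro conjI ballI impI h)
    fix x :: "complex vec" assume x: "x \<in> carrier_vec m" "x \<noteq> 0\<^sub>v m"
    have "\<exists>i<m. x \<bullet>c u i \<noteq> 0"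
    proof (rule ccontr)
      assume "\<not> ?thesis"
      hence "x \<bullet>c w i = 0" if "i < m" for i using that by (auto simp: u_def)
      hence "x \<bullet>c v = 0" if "v \<in> S" for v using w(2) x(1) that by fastforce
      thus False using total[OF x(1)] x(2) by blast
    qed
    hence "0 < (\<Sum>i<m. (cmod (x \<bullet>c u i))\<^sup>2)" by (auto intro!: sum_pos2)
    thus "0 < Re ((?G *\<^sub>v x) \<bullet>c x)" unfolding form[OF x(1)] using m by simp
  qed
  thus ?thesis using h av positive_form_det by blast
qed

section \<open>Norms of functions and their values at points\<close>

lemma sum_fun_apply: "(\<Sum>i\<in>A. g i) x = (\<Sum>i\<in>A. (g i x :: complex))"
  by (induction A rule: infinite_finite_induct) auto

lemma exists_coordinate_functions:
  assumes V: "cfun.subspace V" and dim: "cfun.dim V = m" and m: "m \<ge> 1"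
  shows "\<exists>b :: nat \<Rightarrow> 'a \<Rightarrow> complex. (\<forall>i<m. b i \<in> V) \<and>
     (\<forall>f\<in>V. \<exists>c\<in>carrier_vec m. \<forall>x. f x = (\<Sum>i<m. c $ i * b i x)) \<and>
     (\<forall>c\<in>carrier_vec m. (\<forall>x. (\<Sum>i<m. c $ i * b i x) = 0) \<longrightarrow> c = 0\<^sub>v m)"
proof -
  obtain B where B: "B \<subseteq> V" "cfun.independent B" "V \<subseteq> cfun.span B" "card B = m"
    using cfun.basis_exists[of V] dim by blast
  have fin: "finite B" using B(4) m by (metis card.infinite not_one_le_zero)
  obtain b where b: "bij_betw b {..<m} B"
    using ex_bij_betw_nat_finite[OF fin] B(4) by (auto simp: atLeast0LessThan)
  have inj: "inj_on b {..<m}" and im: "b ` {..<m} = B" using b by (auto simp: bij_betw_def)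
  have sumB: "(\<Sum>v\<in>B. scale_fun (u v) v) x = (\<Sum>i<m. u (b i) * b i x)" for u x
    by (simp add: sum_fun_apply scale_fun_def im[symmetric] sum.reindex[OF inj])
  have "\<exists>c\<in>carrier_vec m. \<forall>x. f x = (\<Sum>i<m. c $ i * b i x)" if "f \<in> V" for f
  proof -
    have "f \<in> range (\<lambda>u. \<Sum>v\<in>B. scale_fun (u v) v)"
      using B(3) that unfolding cfun.span_finite[OF fin] by blast
    then obtain u where "f = (\<Sum>v\<in>B. scale_fun (u v) v)" by (rule rangeE)
    hence "f x = (\<Sum>i<m. vec m (\<lambda>i. u (b i)) $ i * b i x)" for x by (simp add: sumB)
    thus ?thesis by (intro bexI[of _ "vec m (\<lambda>i. u (b i))"]) auto
  qed
  moreover have "c = 0\<^sub>v m" if c: "c \<in> carrier_vec m" "\<forall>x. (\<Sum>i<m. c $ i * b i x) = 0" for c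
  proof (rule ccontr)
    assume "c \<noteq> 0\<^sub>v m"
    then obtain k where k: "k < m" "c $ k \<noteq> 0" using c(1) by (metis carrier_vecD eq_vecI index_zero_vec(1) index_zero_vec(2))
    define u where "u v = c $ (inv_into {..<m} b v)" for v
    have ub: "u (b i) = c $ i" if "i < m" for i using inv_into_f_f[OF inj] that by (simp add: u_def)
    have "(\<Sum>v\<in>B. scale_fun (u v) v) = 0"
      using c(2) by (intro ext) (simp add: sumB ub)
    moreover have "b k \<in> B" "u (b k) \<noteq> 0" using im k ub by auto
    ultimately show False using B(2) cfun.dependent_finite[OF fin] by blast
  qed
  moreover have "b i \<in> V" if "i < m" for i using im B(1) that by auto
  ultimately show ?thesis by blast
qed

lemma Lp_norm_two: "Lp_norm M 2 f = sqrt (\<integral>x. (cmod (f x))\<^sup>2 \<partial>M)"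
  by (simp add: Lp_norm_def powr_half_sqrt)

lemma cmod_le_Lp_norm_inf:
  assumes "f \<in> bounded_functions (space M)" "x \<in> space M"
  shows "cmod (f x) \<le> Lp_norm M \<infinity> f"
proof -
  obtain C where "\<forall>x\<in>space M. cmod (f x) \<le> C"
    using assms(1) by (auto simp: bounded_functions_def bounded_iff)
  hence "bdd_above ((\<lambda>x. cmod (f x)) ` space M)" by (intro bdd_aboveI2) auto
  from cSUP_upper[OF assms(2) this] show ?thesis by (simp add: Lp_norm_def)
qed

lemma Lp_norm_inf_nonneg:
  assumes "prob_space M" "f \<in> bounded_functions (space M)"
  shows "0 \<le> Lp_norm M \<infinity> f"
proof -
  obtain x where "x \<in> space M" using prob_space.not_empty[OF assms(1)] by blast
  from cmod_le_Lp_norm_inf[OF assms(2) this] show ?thesis by (rule order_trans[OF norm_ge_zero])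
qed

lemma Lp_norm_interpolation:
  assumes M: "prob_space M" and f: "f \<in> L2_functions M" and bf: "f \<in> bounded_functions (space M)" and r: "2 \<le> r"
  shows "Lp_norm M (ereal r) f \<le> Lp_norm M 2 f powr (2 / r) * Lp_norm M \<infinity> f powr (1 - 2 / r)"
proof -
  interpret prob_space M by (rule M)
  define s where "s = Lp_norm M \<infinity> f"
  have le: "cmod (f x) \<le> s" if "x \<in> space M" for x
    unfolding s_def by (rule cmod_le_Lp_norm_inf[OF bf that])
  have s0: "0 \<le> s" unfolding s_def by (rule Lp_norm_inf_nonneg[OF M bf])
  have [measurable]: "f \<in> borel_measurable M" and int2: "integrable M (\<lambda>x. (cmod (f x))\<^sup>2)"
    using f by (auto simp: L2_functions_def)
  have pw: "cmod (f x) powr r \<le> s powr (r - 2) * (cmod (f x))\<^sup>2" if "x \<in> space M" for x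
  proof (cases "f x = 0")
    case False
    have "cmod (f x) powr r = cmod (f x) powr (r - 2) * cmod (f x) powr 2"
      by (subst powr_add[symmetric]) simp
    also have "\<dots> \<le> s powr (r - 2) * cmod (f x) powr 2"
      using le[OF that] r by (intro mult_right_mono powr_mono2) auto
    finally show ?thesis using False by simp
  qed (use r in simp)
  have "(\<integral>x. cmod (f x) powr r \<partial>M) \<le> (\<integral>x. s powr (r - 2) * (cmod (f x))\<^sup>2 \<partial>M)"
    using pw int2 by (intro integral_mono') auto
  also have "\<dots> = s powr (r - 2) * (\<integral>x. (cmod (f x))\<^sup>2 \<partial>M)" by simp
  finally have "Lp_norm M (ereal r) f \<le> (s powr (r - 2) * (\<integral>x. (cmod (f x))\<^sup>2 \<partial>M)) powr (1 / r)"
    using r by (simp add: Lp_norm_def powr_mono2)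
  also have "\<dots> = s powr (1 - 2 / r) * (\<integral>x. (cmod (f x))\<^sup>2 \<partial>M) powr (1 / r)"
    using r s0 by (simp add: powr_mult powr_powr diff_divide_distrib)
  also have "(\<integral>x. (cmod (f x))\<^sup>2 \<partial>M) powr (1 / r) = Lp_norm M 2 f powr (2 / r)"
    unfolding Lp_norm_two by (simp add: powr_powr flip: powr_half_sqrt)
  finally show ?thesis by (simp add: s_def mult.commute)
qed

text \<open>
  The factor \<open>k\<close> to the power \<open>1/2 - 1/p\<close> is the geometric interpolation between the factors \<open>1\<close> at exponent
  \<open>2\<close> and \<open>\<surd>k\<close> at exponent \<open>\<infinity>\<close>.
\<close>

lemma Lp_norm_bound_from_endpoints:
  assumes M: "prob_space M" and f: "f \<in> L2_functions M" and bf: "f \<in> bounded_functions (space M)" and p: "2 \<le> p"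
    and a: "0 \<le> a" and k: "k > 0" and q: "0 \<le> q"
    and two: "a * Lp_norm M 2 f \<le> q" and inf: "a * Lp_norm M \<infinity> f \<le> sqrt k * q"
  shows "a * Lp_norm M p f \<le> k powr (1 / 2 - real_of_ereal (1 / p)) * q"
proof (cases p)
  case PInf
  thus ?thesis using inf k by (simp add: powr_half_sqrt)
next
  case (real r)
  have r: "2 \<le> r" using p real by simp
  have n0: "0 \<le> Lp_norm M \<infinity> f" by (rule Lp_norm_inf_nonneg[OF M bf])
  have n2: "0 \<le> Lp_norm M 2 f" unfolding Lp_norm_two by simp
  have split: "y powr (2 / r) * y powr (1 - 2 / r) = y" if "0 \<le> y" for y :: real
    using that by (simp flip: powr_add)
  have "a * Lp_norm M (ereal r) f \<le> a * (Lp_norm M 2 f powr (2 / r) * Lp_norm M \<infinity> f powr (1 - 2 / r))"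
    using Lp_norm_interpolation[OF M f bf r] a by (rule mult_left_mono)
  also have "\<dots> = (a powr (2 / r) * a powr (1 - 2 / r)) * (Lp_norm M 2 f powr (2 / r) * Lp_norm M \<infinity> f powr (1 - 2 / r))"
    using split[OF a] by simp
  also have "\<dots> = (a * Lp_norm M 2 f) powr (2 / r) * (a * Lp_norm M \<infinity> f) powr (1 - 2 / r)"
    using a n0 n2 by (simp add: powr_mult)
  also have "\<dots> \<le> q powr (2 / r) * (sqrt k * q) powr (1 - 2 / r)"
    by (rule mult_mono[OF powr_mono2[OF _ _ two] powr_mono2[OF _ _ inf]]) (use a n0 n2 r in auto)
  also have "\<dots> = sqrt k powr (1 - 2 / r) * (q powr (2 / r) * q powr (1 - 2 / r))"
    using q k by (simp add: powr_mult)
  also have "\<dots> = k powr (1 / 2 - 1 / r) * q"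
    using split[OF q] k by (simp add: powr_powr diff_divide_distrib flip: powr_half_sqrt)
  finally show ?thesis using real r by (simp add: one_ereal_def)
qed (use p in auto)

lemma points_from_list:
  assumes "length xs = n" "set xs \<subseteq> D" "n \<ge> 1" "\<And>f. f \<in> V \<Longrightarrow> P f (\<Sum>x\<leftarrow>xs. g f x)"
  shows "\<exists>x :: nat \<Rightarrow> 'a. (\<forall>i\<in>{1..n}. x i \<in> D) \<and> (\<forall>f\<in>V. P f (\<Sum>i=1..n. g f (x i) :: real))"
proof (intro exI[of _ "\<lambda>i. xs ! (i - 1)"] conjI ballI)
  fix i assume "i \<in> {1..n}"
  hence "xs ! (i - 1) \<in> set xs" using assms(1) by (intro nth_mem) auto
  thus "xs ! (i - 1) \<in> D" using assms(2) by blast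
next
  fix f assume "f \<in> V"
  moreover have "(\<Sum>x\<leftarrow>xs. g f x) = (\<Sum>i=1..n. g f (xs ! (i - 1)))"
    using assms(1) by (simp add: sum_list_sum_nth sum.atLeast1_atMost_eq atLeast0LessThan)
  ultimately show "P f (\<Sum>i=1..n. g f (xs ! (i - 1)))" using assms(4) by metis
qed

section \<open>Discretization in spaces of bounded functions\<close>

context
  fixes M :: "'a measure" and V :: "('a \<Rightarrow> complex) set" and m :: nat
  assumes M: "prob_space M" and V: "cfun.subspace V"
    and sub: "V \<subseteq> L2_functions M \<inter> bounded_functions (space M)"
    and dim: "cfun.dim V = m" and m: "m \<ge> 1"
begin


text \<open>
  The coordinates of \<open>\<phi> x\<close> are conjugated because the scalar product is conjugate linear in its second argument.
  The last property is linear independence of the basis: it holds since functions are determined by their values on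
  the space, not merely almost everywhere.
\<close>

lemma exists_feature_map:
  obtains \<phi> :: "'a \<Rightarrow> complex vec" and K where
    "\<And>x. \<phi> x \<in> carrier_vec m"
    "\<And>i. i < m \<Longrightarrow> (\<lambda>x. \<phi> x $ i) \<in> borel_measurable M"
    "\<And>x i. x \<in> space M \<Longrightarrow> i < m \<Longrightarrow> cmod (\<phi> x $ i) \<le> K"
    "\<And>f. f \<in> V \<Longrightarrow> \<exists>c\<in>carrier_vec m. \<forall>x. f x = c \<bullet>c \<phi> x"
    "\<And>c. c \<in> carrier_vec m \<Longrightarrow> (\<And>v. v \<in> \<phi> ` space M \<Longrightarrow> c \<bullet>c v = 0) \<Longrightarrow> c = 0\<^sub>v m"
proof -
  obtain b where b: "\<And>i. i < m \<Longrightarrow> b i \<in> V"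
    "\<And>f. f \<in> V \<Longrightarrow> \<exists>c\<in>carrier_vec m. \<forall>x. f x = (\<Sum>i<m. c $ i * b i x)"
    "\<And>c. c \<in> carrier_vec m \<Longrightarrow> (\<forall>x. (\<Sum>i<m. c $ i * b i x) = 0) \<Longrightarrow> c = 0\<^sub>v m"
    using exists_coordinate_functions[OF V dim m] by blast
  define \<phi> where "\<phi> x = vec m (\<lambda>i. cnj (b i x))" for x
  have val: "c \<bullet>c \<phi> x = (\<Sum>i<m. c $ i * b i x)" for c x
    by (simp add: cscalar_sum[of _ m] \<phi>_def)
  have cnj: "cnj \<in> borel_measurable borel"
    by (intro borel_measurable_continuous_onI continuous_intros)
  have "bounded (\<Union>i\<in>{..<m}. b i ` space M)"
    using b(1) sub by (intro bounded_UN) (auto simp: bounded_functions_def)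
  then obtain K where K: "\<And>x i. x \<in> space M \<Longrightarrow> i < m \<Longrightarrow> cmod (b i x) \<le> K"
    unfolding bounded_iff by blast
  show thesis
  proof (rule that[of \<phi> K])
    fix i assume i: "i < m"
    have "b i \<in> borel_measurable M" using b(1)[OF i] sub by (auto simp: L2_functions_def)
    hence "(\<lambda>x. cnj (b i x)) \<in> borel_measurable M" by (rule measurable_compose[OF _ cnj])
    thus "(\<lambda>x. \<phi> x $ i) \<in> borel_measurable M" using i by (simp add: \<phi>_def)
  next
    fix c :: "complex vec" assume c: "c \<in> carrier_vec m" "\<And>v. v \<in> \<phi> ` space M \<Longrightarrow> c \<bullet>c v = 0"
    have "(\<Sum>i<m. c $ i * b i x) = 0" for x
    proof (cases "x \<in> space M")
      case True thus ?thesis using c(2)[of "\<phi> x"] by (simp add: val)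
    next
      case False
      hence "b i x = 0" if "i < m" for i
        using b(1)[OF that] sub by (auto simp: bounded_functions_def functions_on_def)
      thus ?thesis by simp
    qed
    thus "c = 0\<^sub>v m" using b(3)[OF c(1)] by blast
  qed (use b(2) K in \<open>auto simp: val\<close>, auto simp: \<phi>_def)
qed

lemma list_of_points:
  assumes "set vs \<subseteq> \<phi> ` D"
  obtains xs where "length xs = length vs" "set xs \<subseteq> D" "map \<phi> xs = vs"
proof (rule that[of "map (inv_into D \<phi>) vs"])
  show "set (map (inv_into D \<phi>) vs) \<subseteq> D" using assms inv_into_into[of _ \<phi> D] by auto
  show "map \<phi> (map (inv_into D \<phi>) vs) = vs"
    using assms by (auto simp: f_inv_into_f intro!: map_idI)
qed simp

lemma Lp_norm_inf_le:
  assumes "\<And>x. x \<in> space M \<Longrightarrow> cmod (f x) \<le> C"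
  shows "Lp_norm M \<infinity> f \<le> C"
  unfolding Lp_norm_def using prob_space.not_empty[OF M] assms by (auto intro!: cSUP_least)

lemma Lp_norm_two_le_inf:
  assumes "f \<in> V"
  shows "Lp_norm M 2 f \<le> Lp_norm M \<infinity> f"
proof -
  interpret prob_space M by (rule M)
  have f: "f \<in> L2_functions M" "f \<in> bounded_functions (space M)" using assms sub by auto
  define s where "s = Lp_norm M \<infinity> f"
  have le: "cmod (f x) \<le> s" if "x \<in> space M" for x
    unfolding s_def by (rule cmod_le_Lp_norm_inf[OF f(2) that])
  have s0: "0 \<le> s" unfolding s_def by (rule Lp_norm_inf_nonneg[OF M f(2)])
  have "(\<integral>x. (cmod (f x))\<^sup>2 \<partial>M) \<le> (\<integral>x. s\<^sup>2 \<partial>M)"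
    using le f(1) by (intro integral_mono) (auto simp: L2_functions_def power_mono)
  also have "\<dots> = s\<^sup>2" by (simp add: prob_space)
  finally have "sqrt (\<integral>x. (cmod (f x))\<^sup>2 \<partial>M) \<le> sqrt (s\<^sup>2)" by (rule real_sqrt_le_mono)
  thus ?thesis unfolding Lp_norm_two s_def[symmetric] using s0 by simp
qed

lemma near_fekete_discretization:
  "\<exists>xs. length xs = m \<and> set xs \<subseteq> space M \<and>
     (\<forall>f\<in>V. 1 / (2 * real m) * Lp_norm M \<infinity> f \<le> sqrt (1 / real m * (\<Sum>x\<leftarrow>xs. (cmod (f x))\<^sup>2)))"
proof -
  obtain \<phi> K where \<phi>: "\<And>x. \<phi> x \<in> carrier_vec m"
    "\<And>i. i < m \<Longrightarrow> (\<lambda>x. \<phi> x $ i) \<in> borel_measurable M"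
    "\<And>x i. x \<in> space M \<Longrightarrow> i < m \<Longrightarrow> cmod (\<phi> x $ i) \<le> K"
    "\<And>f. f \<in> V \<Longrightarrow> \<exists>c\<in>carrier_vec m. \<forall>x. f x = c \<bullet>c \<phi> x"
    "\<And>c. c \<in> carrier_vec m \<Longrightarrow> (\<And>v. v \<in> \<phi> ` space M \<Longrightarrow> c \<bullet>c v = 0) \<Longrightarrow> c = 0\<^sub>v m"
    using exists_feature_map by blast
  have S: "\<phi> ` space M \<subseteq> carrier_vec m" using \<phi>(1) by auto
  have K: "cmod (v $ i) \<le> K" if "v \<in> \<phi> ` space M" "i < m" for v i using \<phi>(3) that by auto
  obtain w where w: "\<forall>i<m. w i \<in> \<phi> ` space M"
    "\<And>c v. c \<in> carrier_vec m \<Longrightarrow> v \<in> \<phi> ` space M \<Longrightarrow> cmod (c \<bullet>c v) \<le> 2 * (\<Sum>i<m. cmod (c \<bullet>c w i))"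
    using near_fekete_points[OF S K \<phi>(5)] by blast
  have "set (map w [0..<m]) \<subseteq> \<phi> ` space M" using w(1) by auto
  then obtain xs where xs: "length xs = m" "set xs \<subseteq> space M" "map \<phi> xs = map w [0..<m]"
    using list_of_points[of "map w [0..<m]" \<phi> "space M"] by auto
  have "1 / (2 * real m) * Lp_norm M \<infinity> f \<le> sqrt (1 / real m * (\<Sum>x\<leftarrow>xs. (cmod (f x))\<^sup>2))" if f: "f \<in> V" for f
  proof -
    obtain c where c: "c \<in> carrier_vec m" "\<And>x. f x = c \<bullet>c \<phi> x" using \<phi>(4)[OF f] by blast
    have fw: "map f xs = map (\<lambda>i. c \<bullet>c w i) [0..<m]"
    proof -
      have "map f xs = map (\<lambda>v. c \<bullet>c v) (map \<phi> xs)" using c(2) by simp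
      also have "\<dots> = map (\<lambda>i. c \<bullet>c w i) [0..<m]" unfolding xs(3) by simp
      finally show ?thesis .
    qed
    define g where "g i = cmod (c \<bullet>c w i)" for i
    have q: "(\<Sum>x\<leftarrow>xs. (cmod (f x))\<^sup>2) = (\<Sum>i<m. (g i)\<^sup>2)"
    proof -
      have "(\<Sum>x\<leftarrow>xs. (cmod (f x))\<^sup>2) = sum_list (map (\<lambda>z. (cmod z)\<^sup>2) (map f xs))" by (simp add: o_def)
      also have "\<dots> = (\<Sum>i<m. (g i)\<^sup>2)" unfolding fw
        by (simp add: o_def g_def interv_sum_list_conv_sum_set_nat atLeast0LessThan)
      finally show ?thesis .
    qed
    have "Lp_norm M \<infinity> f \<le> 2 * (\<Sum>i<m. g i)"
    proof (rule Lp_norm_inf_le)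
      fix x assume "x \<in> space M"
      thus "cmod (f x) \<le> 2 * (\<Sum>i<m. g i)" using w(2)[OF c(1), of "\<phi> x"] c(2) by (simp add: g_def)
    qed
    also have "(\<Sum>i<m. g i) \<le> real m * sqrt (1 / real m * (\<Sum>i<m. (g i)\<^sup>2))"
    proof -
      have "(\<Sum>i<m. g i)\<^sup>2 \<le> (\<Sum>i<m. (g i)\<^sup>2) * (\<Sum>i<m. 1\<^sup>2)"
        using Cauchy_Schwarz_ineq_sum[of g "\<lambda>_. 1" "{..<m}"] by simp
      also have "\<dots> = (real m)\<^sup>2 * (1 / real m * (\<Sum>i<m. (g i)\<^sup>2))" using m by (simp add: power2_eq_square)
      finally have "sqrt ((\<Sum>i<m. g i)\<^sup>2) \<le> sqrt ((real m)\<^sup>2 * (1 / real m * (\<Sum>i<m. (g i)\<^sup>2)))"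
        by (rule real_sqrt_le_mono)
      moreover have "sqrt ((real m)\<^sup>2 * y) = real m * sqrt y" for y by (simp add: real_sqrt_mult)
      moreover have "sqrt ((\<Sum>i<m. g i)\<^sup>2) = (\<Sum>i<m. g i)" by (simp add: g_def sum_nonneg)
      ultimately show ?thesis by (simp only:)
    qed
    finally show ?thesis unfolding q using m by (simp add: field_simps)
  qed
  thus ?thesis using xs(1,2) by blast
qed

text \<open>
  In both parts the selection yields the constant \<open>l + \<sigma>\<close> although only \<open>l\<close> is wanted. The surplus \<open>\<sigma>\<close> pays for
  the perturbation of the Gram matrix in the first part and for the merely approximate optimality of \<open>G\<close> in the
  second.
\<close>

lemma oversampled_discretization:
  assumes n: "m < n"
  shows "\<exists>xs. length xs = n \<and> set xs \<subseteq> space M \<and>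
     (\<forall>f\<in>V. (1 - sqrt (real m / real n)) * Lp_norm M 2 f \<le> sqrt (1 / real n * (\<Sum>x\<leftarrow>xs. (cmod (f x))\<^sup>2)))"
    and "\<exists>xs. length xs = n \<and> set xs \<subseteq> space M \<and>
     (\<forall>f\<in>V. (1 - sqrt (real m / real n)) * Lp_norm M \<infinity> f \<le> sqrt (real m) * sqrt (1 / real n * (\<Sum>x\<leftarrow>xs. (cmod (f x))\<^sup>2)))"
proof -
  obtain \<phi> K where \<phi>: "\<And>x. \<phi> x \<in> carrier_vec m"
    "\<And>i. i < m \<Longrightarrow> (\<lambda>x. \<phi> x $ i) \<in> borel_measurable M"
    "\<And>x i. x \<in> space M \<Longrightarrow> i < m \<Longrightarrow> cmod (\<phi> x $ i) \<le> K"
    "\<And>f. f \<in> V \<Longrightarrow> \<exists>c\<in>carrier_vec m. \<forall>x. f x = c \<bullet>c \<phi> x"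
    "\<And>c. c \<in> carrier_vec m \<Longrightarrow> (\<And>v. v \<in> \<phi> ` space M \<Longrightarrow> c \<bullet>c v = 0) \<Longrightarrow> c = 0\<^sub>v m"
    using exists_feature_map by blast
  let ?S = "\<phi> ` space M"
  have S: "?S \<subseteq> carrier_vec m" using \<phi>(1) by auto
  have K: "cmod (v $ i) \<le> K" if "v \<in> \<phi> ` space M" "i < m" for v i using \<phi>(3) that by auto
  define l \<sigma> where "l = (sqrt n - sqrt m)\<^sup>2" and "\<sigma> = (sqrt n - sqrt m) / sqrt m"
  have l: "l > 0" and \<sigma>: "\<sigma> > 0" using n m by (auto simp: l_def \<sigma>_def)
  have alpha: "1 - sqrt (real m / real n) = sqrt (l / real n)"
    using n m by (simp add: l_def real_sqrt_divide field_simps)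
  obtain G0 where G0: "hermitian_form m G0" "averages_to m ?S G0" "det G0 \<noteq> 0"
    using exists_definite_design[OF S K m \<phi>(5)] by blast
  have select: "\<exists>xs. length xs = n \<and> set xs \<subseteq> space M \<and>
      (\<forall>c\<in>carrier_vec m. (l + \<sigma>) * Re ((G *\<^sub>v c) \<bullet>c c) \<le> (\<Sum>x\<leftarrow>xs. (cmod (c \<bullet>c \<phi> x))\<^sup>2))"
    if G: "averages_to m ?S G" "positive_form m G" for G
  proof -
    have "\<exists>vs. length vs = n \<and> set vs \<subseteq> ?S \<and>
        (\<forall>c\<in>carrier_vec m. (l + \<sigma>) * Re ((G *\<^sub>v c) \<bullet>c c) \<le> (\<Sum>v\<leftarrow>vs. (cmod (c \<bullet>c v))\<^sup>2))"
      unfolding l_def \<sigma>_def by (rule unweighted_selection[OF S G m n])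
    then obtain vs where vs: "length vs = n" "set vs \<subseteq> ?S"
      "\<And>c. c \<in> carrier_vec m \<Longrightarrow> (l + \<sigma>) * Re ((G *\<^sub>v c) \<bullet>c c) \<le> (\<Sum>v\<leftarrow>vs. (cmod (c \<bullet>c v))\<^sup>2)"
      by auto
    obtain xs where xs: "length xs = length vs" "set xs \<subseteq> space M" "map \<phi> xs = vs"
      using list_of_points[OF vs(2)] by blast
    have "(\<Sum>v\<leftarrow>vs. (cmod (c \<bullet>c v))\<^sup>2) = (\<Sum>x\<leftarrow>xs. (cmod (c \<bullet>c \<phi> x))\<^sup>2)" for c
      unfolding xs(3)[symmetric] by (simp add: o_def)
    thus ?thesis using vs(1,3) xs(1,2) by (intro exI[of _ xs] conjI ballI) auto
  qed
  show "\<exists>xs. length xs = n \<and> set xs \<subseteq> space M \<and>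
     (\<forall>f\<in>V. (1 - sqrt (real m / real n)) * Lp_norm M 2 f \<le> sqrt (1 / real n * (\<Sum>x\<leftarrow>xs. (cmod (f x))\<^sup>2)))"
  proof -
    \<comment> \<open>The share of the definite average that turns the constant \<open>l + \<sigma>\<close> into \<open>l\<close>.\<close>
    define t where "t = \<sigma> / (l + \<sigma>)"
    have t: "0 < t" "t < 1" using l \<sigma> by (auto simp: t_def)
    have lt: "(l + \<sigma>) * (1 - t) = l" using l \<sigma> by (simp add: t_def field_simps)
    let ?A = "gram m M \<phi>"
    have Ac: "?A \<in> carrier_mat m m" by (simp add: gram_def)
    have G0c: "G0 \<in> carrier_mat m m" by (rule hermitian_formD(1)[OF G0(1)])
    have hA: "hermitian_form m ?A" and avA: "averages_to m ?S ?A"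
      and fA: "\<And>c. c \<in> carrier_vec m \<Longrightarrow> Re ((?A *\<^sub>v c) \<bullet>c c) = (\<integral>x. (cmod (c \<bullet>c \<phi> x))\<^sup>2 \<partial>M)"
      by (rule gram_hermitian[OF M \<phi>(2,3,1)] averages_to_gram[OF M \<phi>(2,3,1)] gram_form[OF M \<phi>(2,3,1)]; auto)+
    have pG0: "positive_form m G0" by (rule averages_to_positive(2)[OF G0(1,2) S G0(3)])
    define G where "G = complex_of_real (1 - t) \<cdot>\<^sub>m ?A + complex_of_real t \<cdot>\<^sub>m G0"
    have formG: "Re ((G *\<^sub>v c) \<bullet>c c) = (1 - t) * (\<integral>x. (cmod (c \<bullet>c \<phi> x))\<^sup>2 \<partial>M) + t * Re ((G0 *\<^sub>v c) \<bullet>c c)"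
      if c: "c \<in> carrier_vec m" for c
      using Ac G0c c fA[OF c] unfolding G_def
      by (simp add: add_mult_distrib_mat_vec[of _ m m] smult_mat_mult_vec[of _ m] cscalar_add_left[of _ m]
         cscalar_smult_left[of _ m] square_mat_closed del: of_real_diff)
    have avG: "averages_to m ?S G" unfolding G_def using t by (intro averages_to_mix avA Ac G0(2) G0c) auto
    have pG: "positive_form m G"
      unfolding positive_form_def
    proof (intro conjI ballI impI)
      show "hermitian_form m G" unfolding G_def by (intro hermitian_add hermitian_smult hA G0(1))
      fix x :: "complex vec" assume x: "x \<in> carrier_vec m" "x \<noteq> 0\<^sub>v m"
      have "0 < Re ((G0 *\<^sub>v x) \<bullet>c x)" using pG0 x by (simp add: positive_form_def)
      thus "0 < Re ((G *\<^sub>v x) \<bullet>c x)" unfolding formG[OF x(1)] using t by (intro add_nonneg_pos) auto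
    qed
    obtain xs where xs: "length xs = n" "set xs \<subseteq> space M"
      "\<And>c. c \<in> carrier_vec m \<Longrightarrow> (l + \<sigma>) * Re ((G *\<^sub>v c) \<bullet>c c) \<le> (\<Sum>x\<leftarrow>xs. (cmod (c \<bullet>c \<phi> x))\<^sup>2)"
      using select[OF avG pG] by blast
    have "sqrt (l / real n) * Lp_norm M 2 f \<le> sqrt (1 / real n * (\<Sum>x\<leftarrow>xs. (cmod (f x))\<^sup>2))" if f: "f \<in> V" for f
    proof -
      obtain c where c: "c \<in> carrier_vec m" "\<And>x. f x = c \<bullet>c \<phi> x" using \<phi>(4)[OF f] by blast
      have "l * (\<integral>x. (cmod (f x))\<^sup>2 \<partial>M) = (l + \<sigma>) * ((1 - t) * (\<integral>x. (cmod (f x))\<^sup>2 \<partial>M))"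
        using lt by (simp flip: mult.assoc)
      also have "\<dots> \<le> (l + \<sigma>) * Re ((G *\<^sub>v c) \<bullet>c c)"
        using formG[OF c(1)] positive_form_nonneg[OF pG0 c(1)] t l \<sigma> c(2) by (intro mult_left_mono) auto
      also have "\<dots> \<le> (\<Sum>x\<leftarrow>xs. (cmod (f x))\<^sup>2)" using xs(3)[OF c(1)] c(2) by simp
      finally have "l / real n * (\<integral>x. (cmod (f x))\<^sup>2 \<partial>M) \<le> 1 / real n * (\<Sum>x\<leftarrow>xs. (cmod (f x))\<^sup>2)"
        using n by (simp add: divide_right_mono)
      hence "sqrt (l / real n * (\<integral>x. (cmod (f x))\<^sup>2 \<partial>M)) \<le> sqrt (1 / real n * (\<Sum>x\<leftarrow>xs. (cmod (f x))\<^sup>2))"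
        by (rule real_sqrt_le_mono)
      thus ?thesis unfolding Lp_norm_two by (simp only: real_sqrt_mult)
    qed
    thus ?thesis unfolding alpha using xs(1,2) by blast
  qed
  show "\<exists>xs. length xs = n \<and> set xs \<subseteq> space M \<and>
     (\<forall>f\<in>V. (1 - sqrt (real m / real n)) * Lp_norm M \<infinity> f \<le> sqrt (real m) * sqrt (1 / real n * (\<Sum>x\<leftarrow>xs. (cmod (f x))\<^sup>2)))"
  proof -
    \<comment> \<open>With \<open>\<eta> = m \<sigma> / l\<close> the bound \<open>m + \<eta>\<close> is \<open>m (l + \<sigma>) / l\<close>, which cancels the constant of the selection.\<close>
    have eta: "real m * \<sigma> / l > 0" using m \<sigma> l by simp
    obtain G R where G: "positive_form m G" "averages_to m ?S G" "inverse_mats m G R"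
      "\<And>v. v \<in> ?S \<Longrightarrow> Re ((R *\<^sub>v v) \<bullet>c v) \<le> real m + real m * \<sigma> / l"
      using near_optimal_design[OF S K G0 m eta] by blast
    obtain xs where xs: "length xs = n" "set xs \<subseteq> space M"
      "\<And>c. c \<in> carrier_vec m \<Longrightarrow> (l + \<sigma>) * Re ((G *\<^sub>v c) \<bullet>c c) \<le> (\<Sum>x\<leftarrow>xs. (cmod (c \<bullet>c \<phi> x))\<^sup>2)"
      using select[OF G(2,1)] by blast
    have "sqrt (l / real n) * Lp_norm M \<infinity> f \<le> sqrt (real m) * sqrt (1 / real n * (\<Sum>x\<leftarrow>xs. (cmod (f x))\<^sup>2))"
      if f: "f \<in> V" for f
    proof -
      obtain c where c: "c \<in> carrier_vec m" "\<And>x. f x = c \<bullet>c \<phi> x" using \<phi>(4)[OF f] by blast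
      define Q where "Q = (\<Sum>x\<leftarrow>xs. (cmod (f x))\<^sup>2)"
      define g where "g = Re ((G *\<^sub>v c) \<bullet>c c)"
      have g0: "0 \<le> g" unfolding g_def by (rule positive_form_nonneg[OF G(1) c(1)])
      have Q: "(l + \<sigma>) * g \<le> Q" using xs(3)[OF c(1)] c(2) by (simp add: g_def Q_def)
      have "cmod (f x) \<le> sqrt (real m * Q / l)" if x: "x \<in> space M" for x
      proof -
        have "(cmod (f x))\<^sup>2 \<le> Re ((R *\<^sub>v \<phi> x) \<bullet>c \<phi> x) * g"
          unfolding c(2) g_def by (rule dual_cauchy_schwarz[OF G(1,3) \<phi>(1) c(1)])
        also have "\<dots> \<le> (real m + real m * \<sigma> / l) * g" using G(4)[of "\<phi> x"] x g0 by (intro mult_right_mono) auto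
        also have "\<dots> = real m * ((l + \<sigma>) * g) / l" using l by (simp add: field_simps)
        also have "\<dots> \<le> real m * Q / l" using Q l by (intro divide_right_mono mult_left_mono) auto
        finally have "sqrt ((cmod (f x))\<^sup>2) \<le> sqrt (real m * Q / l)" by (rule real_sqrt_le_mono)
        thus ?thesis by simp
      qed
      hence "Lp_norm M \<infinity> f \<le> sqrt (real m * Q / l)" by (rule Lp_norm_inf_le)
      hence "sqrt (l / real n) * Lp_norm M \<infinity> f \<le> sqrt (l / real n) * sqrt (real m * Q / l)"
        using l by (intro mult_left_mono) auto
      also have "\<dots> = sqrt (real m) * sqrt (1 / real n * Q)"
        unfolding real_sqrt_mult[symmetric] using l by simp
      finally show ?thesis by (simp add: Q_def)
    qed
    thus ?thesis unfolding alpha using xs(1,2) by blast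
  qed
qed

lemma all_norms_discretization:
  assumes a: "0 \<le> a" and n: "n \<ge> 1"
    and two: "length xs = n" "set xs \<subseteq> space M"
      "\<And>f. f \<in> V \<Longrightarrow> a * Lp_norm M 2 f \<le> sqrt (1 / real n * (\<Sum>x\<leftarrow>xs. (cmod (f x))\<^sup>2))"
    and inf: "length ys = n" "set ys \<subseteq> space M"
      "\<And>f. f \<in> V \<Longrightarrow> a * Lp_norm M \<infinity> f \<le> sqrt (real m) * sqrt (1 / real n * (\<Sum>x\<leftarrow>ys. (cmod (f x))\<^sup>2))"
  shows "\<exists>x :: nat \<Rightarrow> 'a. (\<forall>i\<in>{1..2*n}. x i \<in> space M) \<and>
        (\<forall>f\<in>V. \<forall>p::ereal. 2 \<le> p \<longrightarrow>
          a * Lp_norm M p f \<le> real m powr (1 / 2 - real_of_ereal (1 / p))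
               * sqrt (1 / real n * (\<Sum>i=1..2*n. (cmod (f (x i)))\<^sup>2)))"
    and "\<forall>p\<in>{2, \<infinity>::ereal}. \<exists>x :: nat \<Rightarrow> 'a. (\<forall>i\<in>{1..n}. x i \<in> space M) \<and>
        (\<forall>f\<in>V. a * Lp_norm M p f \<le> real m powr (1 / 2 - real_of_ereal (1 / p))
               * sqrt (1 / real n * (\<Sum>i=1..n. (cmod (f (x i)))\<^sup>2)))"
proof -
  have m0: "real m > 0" using m by simp
  show "\<exists>x :: nat \<Rightarrow> 'a. (\<forall>i\<in>{1..2*n}. x i \<in> space M) \<and>
        (\<forall>f\<in>V. \<forall>p::ereal. 2 \<le> p \<longrightarrow>
          a * Lp_norm M p f \<le> real m powr (1 / 2 - real_of_ereal (1 / p))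
               * sqrt (1 / real n * (\<Sum>i=1..2*n. (cmod (f (x i)))\<^sup>2)))"
  proof (rule points_from_list[of "xs @ ys"])
    fix f assume f: "f \<in> V"
    let ?X = "\<Sum>x\<leftarrow>xs. (cmod (f x))\<^sup>2" and ?Y = "\<Sum>x\<leftarrow>ys. (cmod (f x))\<^sup>2" and ?Q = "\<Sum>x\<leftarrow>xs @ ys. (cmod (f x))\<^sup>2"
    have nn: "0 \<le> ?X" "0 \<le> ?Y" by (auto intro!: sum_list_nonneg)
    have le: "sqrt (1 / real n * ?X) \<le> sqrt (1 / real n * ?Q)" "sqrt (1 / real n * ?Y) \<le> sqrt (1 / real n * ?Q)"
      using nn by (auto intro!: divide_right_mono)
    show "\<forall>p::ereal. 2 \<le> p \<longrightarrow> a * Lp_norm M p f \<le> real m powr (1 / 2 - real_of_ereal (1 / p)) * sqrt (1 / real n * ?Q)"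
    proof (intro allI impI)
      fix p :: ereal assume p: "2 \<le> p"
      show "a * Lp_norm M p f \<le> real m powr (1 / 2 - real_of_ereal (1 / p)) * sqrt (1 / real n * ?Q)"
      proof (rule Lp_norm_bound_from_endpoints[OF M _ _ p a m0])
        show "a * Lp_norm M 2 f \<le> sqrt (1 / real n * ?Q)" using two(3)[OF f] le(1) by (rule order_trans)
        have "sqrt (real m) * sqrt (1 / real n * ?Y) \<le> sqrt (real m) * sqrt (1 / real n * ?Q)"
          using le(2) by (rule mult_left_mono) simp
        with inf(3)[OF f] show "a * Lp_norm M \<infinity> f \<le> sqrt (real m) * sqrt (1 / real n * ?Q)" by (rule order_trans)
      qed (use f sub nn in \<open>auto intro!: divide_nonneg_nonneg\<close>)
    qed
  qed (use two inf n in auto)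
  show "\<forall>p\<in>{2, \<infinity>::ereal}. \<exists>x :: nat \<Rightarrow> 'a. (\<forall>i\<in>{1..n}. x i \<in> space M) \<and>
        (\<forall>f\<in>V. a * Lp_norm M p f \<le> real m powr (1 / 2 - real_of_ereal (1 / p))
               * sqrt (1 / real n * (\<Sum>i=1..n. (cmod (f (x i)))\<^sup>2)))"
  proof
    fix p :: ereal assume "p \<in> {2, \<infinity>}"
    then consider "p = 2" | "p = \<infinity>" by blast
    thus "\<exists>x :: nat \<Rightarrow> 'a. (\<forall>i\<in>{1..n}. x i \<in> space M) \<and>
        (\<forall>f\<in>V. a * Lp_norm M p f \<le> real m powr (1 / 2 - real_of_ereal (1 / p))
               * sqrt (1 / real n * (\<Sum>i=1..n. (cmod (f (x i)))\<^sup>2)))"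
    proof cases
      case 1
      have e: "real_of_ereal (1 / 2) = 1 / 2"
        by (metis numeral_eq_ereal one_ereal_def ereal_divide real_of_ereal.simps(1) zero_neq_numeral)
      hence pw: "real m powr (1 / 2 - real_of_ereal (1 / 2)) = 1" unfolding e using m by simp
      show ?thesis unfolding 1 pw mult_1_left
        by (rule points_from_list[OF two(1,2) n]) (use two(3) in auto)
    next
      case 2
      show ?thesis unfolding 2
        by (rule points_from_list[OF inf(1,2) n]) (use inf(3) m in \<open>auto simp: powr_half_sqrt\<close>)
    qed
  qed
qed

end


theorem proposition8:
  fixes M :: "'a measure" and V :: "('a \<Rightarrow> complex) set" and m n :: nat
  assumes "prob_space M"
    and "cfun.subspace V"
    and "V \<subseteq> L2_functions M \<inter> bounded_functions (space M)"
    and "cfun.dim V = m"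
    and "m \<ge> 1"
    and "n \<ge> m"
  shows
    "(\<exists>x :: nat \<Rightarrow> 'a. (\<forall>i\<in>{1..2*n}. x i \<in> space M) \<and>
        (\<forall>f\<in>V. \<forall>p::ereal. 2 \<le> p \<longrightarrow>
          (1 - sqrt (real m / real n)) * Lp_norm M p f
            \<le> real m powr (1 / 2 - real_of_ereal (1 / p))
               * sqrt (1 / real n * (\<Sum>i=1..2*n. (cmod (f (x i)))\<^sup>2))))
     \<and>
     (\<forall>p\<in>{2, \<infinity>::ereal}. \<exists>x :: nat \<Rightarrow> 'a. (\<forall>i\<in>{1..n}. x i \<in> space M) \<and>
        (\<forall>f\<in>V.
          (1 - sqrt (real m / real n)) * Lp_norm M p f
            \<le> real m powr (1 / 2 - real_of_ereal (1 / p))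
               * sqrt (1 / real n * (\<Sum>i=1..n. (cmod (f (x i)))\<^sup>2))))
     \<and>
     (n = m \<longrightarrow>
       (\<exists>x :: nat \<Rightarrow> 'a. (\<forall>i\<in>{1..2*n}. x i \<in> space M) \<and>
          (\<forall>f\<in>V. \<forall>p::ereal. 2 \<le> p \<longrightarrow>
            1 / (2 * real m) * Lp_norm M p f
              \<le> real m powr (1 / 2 - real_of_ereal (1 / p))
                 * sqrt (1 / real n * (\<Sum>i=1..2*n. (cmod (f (x i)))\<^sup>2))))
       \<and>
       (\<forall>p\<in>{2, \<infinity>::ereal}. \<exists>x :: nat \<Rightarrow> 'a. (\<forall>i\<in>{1..n}. x i \<in> space M) \<and>
          (\<forall>f\<in>V.
            1 / (2 * real m) * Lp_norm M p f
              \<le> real m powr (1 / 2 - real_of_ereal (1 / p))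
                 * sqrt (1 / real n * (\<Sum>i=1..n. (cmod (f (x i)))\<^sup>2)))))"
    (is "?all n \<and> ?endpoints n \<and> (n = m \<longrightarrow> ?square)")
proof (cases "n = m")
  case False
  hence n: "m < n" "n \<ge> 1" using assms by auto
  have a: "0 \<le> 1 - sqrt (real m / real n)" using n by simp
  note ctx = assms(1-5)
  obtain xs where xs: "length xs = n" "set xs \<subseteq> space M"
    "\<And>f. f \<in> V \<Longrightarrow> (1 - sqrt (real m / real n)) * Lp_norm M 2 f \<le> sqrt (1 / real n * (\<Sum>x\<leftarrow>xs. (cmod (f x))\<^sup>2))"
    using oversampled_discretization(1)[OF ctx n(1)] by blast
  obtain ys where ys: "length ys = n" "set ys \<subseteq> space M"
    "\<And>f. f \<in> V \<Longrightarrow> (1 - sqrt (real m / real n)) * Lp_norm M \<infinity> f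
       \<le> sqrt (real m) * sqrt (1 / real n * (\<Sum>x\<leftarrow>ys. (cmod (f x))\<^sup>2))"
    using oversampled_discretization(2)[OF ctx n(1)] by blast
  show ?thesis
    using all_norms_discretization[OF ctx a n(2) xs ys] False by (intro conjI) blast+
next
  case True
  note ctx = assms(1-5)
  obtain xs where xs: "length xs = m" "set xs \<subseteq> space M"
    "\<And>f. f \<in> V \<Longrightarrow> 1 / (2 * real m) * Lp_norm M \<infinity> f \<le> sqrt (1 / real m * (\<Sum>x\<leftarrow>xs. (cmod (f x))\<^sup>2))"
    using near_fekete_discretization[OF ctx] by blast
  have b: "0 \<le> 1 / (2 * real m)" by simp
  have two: "1 / (2 * real m) * Lp_norm M 2 f \<le> sqrt (1 / real m * (\<Sum>x\<leftarrow>xs. (cmod (f x))\<^sup>2))" if "f \<in> V" for f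
    using mult_left_mono[OF Lp_norm_two_le_inf[OF ctx that] b] xs(3)[OF that] by (rule order_trans)
  have inf: "1 / (2 * real m) * Lp_norm M \<infinity> f \<le> sqrt (real m) * sqrt (1 / real m * (\<Sum>x\<leftarrow>xs. (cmod (f x))\<^sup>2))" if "f \<in> V" for f
  proof -
    have "1 * sqrt (1 / real m * (\<Sum>x\<leftarrow>xs. (cmod (f x))\<^sup>2)) \<le> sqrt (real m) * sqrt (1 / real m * (\<Sum>x\<leftarrow>xs. (cmod (f x))\<^sup>2))"
      using assms(5) by (intro mult_right_mono) (auto intro!: sum_list_nonneg divide_nonneg_nonneg)
    with xs(3)[OF that] show ?thesis by simp
  qed
  have square: ?square
    unfolding True using all_norms_discretization[OF ctx b assms(5) xs(1,2) two xs(1,2) inf] by (intro conjI) blast+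
  \<comment> \<open>The first two claims hold for arbitrary points, as their left-hand sides are zero.\<close>
  have zero: "1 - sqrt (real m / real n) = 0" using True assms(5) by simp
  obtain x0 where x0: "x0 \<in> space M" using prob_space.not_empty[OF assms(1)] by blast
  have "?all n" "?endpoints n"
    unfolding zero using x0 by (auto intro!: exI[of _ "\<lambda>_. x0"] mult_nonneg_nonneg sum_nonneg divide_nonneg_nonneg)
  thus ?thesis using square by blast
qed

end
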